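(* Let $\mathbb{F}_q$ be a finite field of characteristic $p\ge 5$, and let $I_{\mathrm{T}}(q)$ be the number of $\mathbb{F}_q$-isomorphism classes of elliptic curves in the family $\mathbf{E}_{\mathrm{T},u}: Y^2=X^3+3u(X+1)^2$, $u\in\mathbb{F}_q\setminus\{0,9/4\}$. Then $$ I_{\mathrm{T}}(q)=\begin{cases} (5q-2)/6-(N_1-25)/96 & \text{if } q\equiv 1 \pmod{24},\\ (5q+1)/6-(N_1-25)/96 & \text{if } q\equiv 13 \pmod{24},\\ 5(q-1)/6-(N_1-25)/96 & \text{if } q\equiv 7 \pmod{12},\\ q-1-N_2/4 & \text{if } q\equiv 2 \pmod 3, \end{cases}$$ where, for $q\equiv 1\pmod 3$ and $\zeta$ a nontrivial cube root of unity in $\mathbb{F}_q$, $N_1$ is the number of $\mathbb{F}_q$-rational affine points $(X,Y,Z,W)$ of the curve $\mathcal{C}$ given by $$\begin{cases} Y^2=3X(X+1)(X-2),\\ Z^2=3\zeta X(\zeta X+1)(\zeta X-2),\\ W^2=3\zeta^2X(\zeta^2X+1)(\zeta^2X-2), \end{cases}$$ and $N_2$ is the number of $\mathbb{F}_q$-rational points of the Legendre elliptic curve $\mathcal{L}: Y^2=X(X-1)(X-1/3)$.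
   Context: The condition $u\ne 0,9/4$ ensures that $\mathbf{E}_{\mathrm{T},u}$ is nonsingular, hence an elliptic curve (with the point at infinity as base point). Two elliptic curves given by Weierstrass equations over $\mathbb{F}_q$ are $\mathbb{F}_q$-isomorphic if there is a change of variables between them of the form $(x,y)\mapsto(\alpha^2x+r,\alpha^3y+\alpha^2sx+t)$ with $\alpha,r,s,t\in\mathbb{F}_q$, $\alpha\neq 0$. Thus $I_{\mathrm{T}}(q)$ is the number of classes into which the curves $\mathbf{E}_{\mathrm{T},u}$, $u\in\mathbb{F}_q\setminus\{0,9/4\}$, are partitioned by $\mathbb{F}_q$-isomorphism. $N_1$ counts affine solutions $(X,Y,Z,W)\in\mathbb{F}_q^4$ only, while $N_2=\#\mathcal{L}(\mathbb{F}_q)$ is the number of points of the elliptic curve $\mathcal{L}$, including the point at infinity. *)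

theory Defs
  imports
    "HOL-Computational_Algebra.Computational_Algebra"
    "HOL-Number_Theory.Cong"
    "HOL-Library.Cardinality"
begin

(* The Weierstrass equation Y^2 + a1 X Y + a3 Y = X^3 + a2 X^2 + a4 X + a6. *)
datatype 'a weierstrass =
  Weierstrass (a1: 'a) (a2: 'a) (a3: 'a) (a4: 'a) (a6: 'a)

(* Elements of 'a poly poly are the bivariate polynomials over 'a: the inner
   variable is X, the outer one is Y. *)
abbreviation scal :: "'a::comm_ring_1 \<Rightarrow> 'a poly poly"
  where "scal c \<equiv> [:[:c:]:]"

abbreviation var_X :: "'a::comm_ring_1 poly poly"
  where "var_X \<equiv> [:[:0, 1:]:]"

abbreviation var_Y :: "'a::comm_ring_1 poly poly"
  where "var_Y \<equiv> [:0, 1:]"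

(* "Left-hand side minus right-hand side" of the equation of E, with the
   polynomials x and y substituted for its two variables. *)
definition weierstrass_subst ::
    "'a::comm_ring_1 weierstrass \<Rightarrow> 'a poly poly \<Rightarrow> 'a poly poly \<Rightarrow> 'a poly poly"
  where "weierstrass_subst E x y =
    y ^ 2 + scal (a1 E) * x * y + scal (a3 E) * y
      - (x ^ 3 + scal (a2 E) * x ^ 2 + scal (a4 E) * x + scal (a6 E))"

(* The change of variables (x, y) |-> (alpha^2 x + r, alpha^3 y + alpha^2 s x + t)
   takes E to E': substituting it into the equation of E' gives the equation of E
   up to a nonzero constant, which is alpha^6 as one sees from the coefficient of Y^2.
   This is an identity of polynomials, which over a finite field says more than
   equality at all rational points. *)
definition weierstrass_iso :: "'a::field weierstrass \<Rightarrow> 'a weierstrass \<Rightarrow> bool"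
  where "weierstrass_iso E E' \<longleftrightarrow>
    (\<exists>\<alpha> r s t. \<alpha> \<noteq> 0 \<and>
      weierstrass_subst E' (scal (\<alpha> ^ 2) * var_X + scal r)
          (scal (\<alpha> ^ 3) * var_Y + scal (\<alpha> ^ 2 * s) * var_X + scal t)
        = scal (\<alpha> ^ 6) * weierstrass_subst E var_X var_Y)"

definition affine_points :: "'a::comm_ring_1 weierstrass \<Rightarrow> ('a \<times> 'a) set"
  where "affine_points E = {(x, y).
    y ^ 2 + a1 E * x * y + a3 E * y = x ^ 3 + a2 E * x ^ 2 + a4 E * x + a6 E}"

(* None is the point at infinity. *)
definition rational_points :: "'a::comm_ring_1 weierstrass \<Rightarrow> ('a \<times> 'a) option set"
  where "rational_points E = insert None (Some ` affine_points E)"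

definition E_T :: "'a::comm_ring_1 \<Rightarrow> 'a weierstrass"
  where "E_T u = Weierstrass 0 (3 * u) 0 (6 * u) (3 * u)"

lemma affine_points_E_T:
  "affine_points (E_T u) = {(x, y). y ^ 2 = x ^ 3 + 3 * u * (x + 1) ^ 2}"
  by (simp add: affine_points_def E_T_def power2_eq_square algebra_simps)

definition E_T_family :: "'a::field weierstrass set"
  where "E_T_family = E_T ` (UNIV - {0, 9 / 4})"

definition I_T :: "'a::finite_field itself \<Rightarrow> nat"
  where "I_T _ = card ((E_T_family :: 'a weierstrass set) //
    {(E, E'). E \<in> E_T_family \<and> E' \<in> E_T_family \<and> weierstrass_iso E E'})"

(* For q = 1 (mod 3) there is a zeta to define the curve C with. *)
lemma nontrivial_cube_root_of_unity_exists:
  assumes "[card (UNIV :: 'a::finite_field set) = 1] (mod 3)"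
  shows "\<exists>\<zeta>::'a. \<zeta> ^ 3 = 1 \<and> \<zeta> \<noteq> 1"
proof -
  define n where "n = (CARD('a) - 1) div 3"
  have "card {0, 1 :: 'a} \<le> CARD('a)"
    by (intro card_mono) auto
  hence gt1: "CARD('a) \<ge> 2"
    by simp
  have n: "CARD('a) = 3 * n + 1"
    using assms gt1 unfolding n_def cong_def by presburger
  have "n > 0"
    using n gt1 by simp
  define p :: "'a poly" where "p = monom 1 n + [:-1:]"
  have deg: "degree p = n"
    using \<open>n > 0\<close> unfolding p_def
    by (subst degree_add_eq_left) (simp_all add: degree_monom_eq)
  have "p \<noteq> 0"
    using deg \<open>n > 0\<close> by auto
  have "card {x. poly p x = 0} \<le> n"
    using card_poly_roots_bound[OF \<open>p \<noteq> 0\<close>] deg by simp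
  moreover have "card (UNIV - {0 :: 'a}) = 3 * n"
    using n by (simp add: card_Diff_singleton)
  ultimately have "\<not> UNIV - {0 :: 'a} \<subseteq> {x. poly p x = 0}"
    using card_mono[of "{x. poly p x = 0}" "UNIV - {0}"] \<open>n > 0\<close> by auto
  then obtain a :: 'a where "a \<noteq> 0" "a ^ n \<noteq> 1"
    by (auto simp: p_def poly_monom)
  moreover have "a ^ (3 * n) = 1"
    using finite_field_power_card_eq_same[of a] n \<open>a \<noteq> 0\<close> by simp
  ultimately show ?thesis
    by (intro exI[of _ "a ^ n"]) (simp add: power_mult[symmetric] mult.commute)
qed

definition curve_C_points :: "'a::comm_ring_1 \<Rightarrow> ('a \<times> 'a \<times> 'a \<times> 'a) set"
  where "curve_C_points \<zeta> = {(X, Y, Z, W).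
    Y ^ 2 = 3 * X * (X + 1) * (X - 2) \<and>
    Z ^ 2 = 3 * \<zeta> * X * (\<zeta> * X + 1) * (\<zeta> * X - 2) \<and>
    W ^ 2 = 3 * \<zeta> ^ 2 * X * (\<zeta> ^ 2 * X + 1) * (\<zeta> ^ 2 * X - 2)}"

definition legendre :: "'a::comm_ring_1 \<Rightarrow> 'a weierstrass"
  where "legendre c = Weierstrass 0 (- (1 + c)) 0 c 0"

lemma affine_points_legendre:
  "affine_points (legendre c) = {(x, y). y ^ 2 = x * (x - 1) * (x - c)}"
  by (simp add: affine_points_def legendre_def power2_eq_square power3_eq_cube algebra_simps)

definition N1 :: "'a::finite_field \<Rightarrow> nat"
  where "N1 \<zeta> = card (curve_C_points \<zeta>)"

definition N2 :: "'a::finite_field itself \<Rightarrow> nat"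
  where "N2 _ = card (rational_points (legendre (1 / 3 :: 'a)))"

end

theory Submission
  imports Defs
begin

text \<open>
  The curve E_u is in the form that marks the subgroup of order 3 generated by (0, sqrt(3u)).
  Isomorphisms within the family thus come from the other subgroups of order 3. In terms of
  c = 4u/(9 - 4u) these correspond to the cube roots X of c: moving the marking to X gives the
  curve with parameter F(X)^3, where F(X) = (2 - X)/(1 + X), and the two curves are quadratic twists of
  each other by f(X) = 3X(X + 1)(X - 2). Hence the class of c consists of c and of the F(X)^3 with
  f(X) a nonzero square, and the number of classes is the sum over c of 1/|class of c|.

  If q = 2 (mod 3), cubing is a bijection and a class has two elements precisely if f(X) is a
  nonzero square; these X are counted by the Legendre curve. If q = 1 (mod 3), a c that is not a
  cube is alone in its class, while for c = X^3 with j different from 0 and 1728 the class has 1 + n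
  elements, n being the number of nonzero squares among f(X), f(\<zeta>X), f(\<zeta>^2 X). The involution F
  maps the X with n = 0 to the X with n = 2 for which f(X) is the nonsquare, so that 1/(1 + n) can be
  replaced in the sum by 1/2 - [n = 3]/4. The X with n = 3 are counted by the curve C.
\<close>

section \<open>Isomorphisms within the family\<close>

text \<open>Comparison of coefficients. Those of XY and Y are 2 \<alpha>^5 s and 2 \<alpha>^3 t, so
  that \<open>s\<close> and \<open>t\<close> vanish; the three remaining equations come from the
  constant term, X and X^2.\<close>

lemma weierstrass_iso_E_T_coeffs:
  fixes u v :: "'a::field"
  assumes two: "(2::'a) \<noteq> 0"
  shows "weierstrass_iso (E_T u) (E_T v) \<longleftrightarrow> (\<exists>\<alpha> r. \<alpha> \<noteq> 0 \<and>
      r ^ 3 + 3 * v * r ^ 2 + 6 * v * r + 3 * v = 3 * u * \<alpha> ^ 6 \<and>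
      \<alpha> ^ 2 * (3 * r ^ 2 + 6 * r * v + 6 * v) = 6 * u * \<alpha> ^ 6 \<and>
      \<alpha> ^ 4 * (3 * r + 3 * v) = 3 * u * \<alpha> ^ 6)" (is "?L \<longleftrightarrow> (\<exists>\<alpha> r. ?C \<alpha> r)")
proof
  assume ?L
  then obtain \<alpha> r s t where \<alpha>: "\<alpha> \<noteq> 0" and
    eq: "weierstrass_subst (E_T v) (scal (\<alpha> ^ 2) * var_X + scal r)
        (scal (\<alpha> ^ 3) * var_Y + scal (\<alpha> ^ 2 * s) * var_X + scal t)
      = scal (\<alpha> ^ 6) * weierstrass_subst (E_T u) var_X var_Y"
    unfolding weierstrass_iso_def by blast
  have eqs: "t * t - (r * r * r + r * r * (3 * v) + 6 * v * r + 3 * v) = - (3 * u * \<alpha> ^ 6)"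
      "2 * (\<alpha> * (\<alpha> * (s * t))) - (3 * (\<alpha> * (\<alpha> * (r * r))) + 6 * (\<alpha> * (\<alpha> * (r * v))) +
         6 * v * (\<alpha> * \<alpha>)) = - (6 * u * \<alpha> ^ 6)"
      "\<alpha> * \<alpha> * s * (\<alpha> * \<alpha> * s) - (3 * (\<alpha> * (\<alpha> * (\<alpha> * (\<alpha> * r)))) +
         \<alpha> * \<alpha> * (\<alpha> * \<alpha>) * (3 * v)) = - (3 * u * \<alpha> ^ 6)"
    and st: "\<alpha> = 0 \<or> t = 0" "\<alpha> = 0 \<or> s = 0"
    using eq two
    by (simp_all add: weierstrass_subst_def E_T_def)
      (simp_all add: power2_eq_square power3_eq_cube)
  have "s = 0" "t = 0" using st \<alpha> by auto
  note eqs = eqs[unfolded this]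
  have "?C \<alpha> r"
  proof (intro conjI)
    show "r ^ 3 + 3 * v * r ^ 2 + 6 * v * r + 3 * v = 3 * u * \<alpha> ^ 6"
      using eqs(1) by (simp add: power2_eq_square power3_eq_cube algebra_simps)
    show "\<alpha> ^ 2 * (3 * r ^ 2 + 6 * r * v + 6 * v) = 6 * u * \<alpha> ^ 6"
      using eqs(2) by (simp add: power2_eq_square algebra_simps)
    show "\<alpha> ^ 4 * (3 * r + 3 * v) = 3 * u * \<alpha> ^ 6"
      using eqs(3) by (simp add: power4_eq_xxxx algebra_simps)
  qed fact
  thus "\<exists>\<alpha> r. ?C \<alpha> r" by blast
next
  assume "\<exists>\<alpha> r. ?C \<alpha> r"
  then obtain \<alpha> r where C: "?C \<alpha> r" by blast
  show ?L
    unfolding weierstrass_iso_def weierstrass_subst_def E_T_def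
    apply (rule exI[of _ \<alpha>], rule exI[of _ r], rule exI[of _ 0], rule exI[of _ 0])
    apply (simp add: power2_eq_square power3_eq_cube)
    using C
    apply (elim conjE)
    apply (intro conjI)
         apply assumption
        apply (simp_all add: power2_eq_square power3_eq_cube power4_eq_xxxx algebra_simps)
     apply (simp_all add: eval_nat_numeral)
    done
qed

definition nz_square :: "'a::field \<Rightarrow> bool" where
  "nz_square x \<longleftrightarrow> x \<noteq> 0 \<and> (\<exists>y. x = y ^ 2)"

text \<open>The shift x -> x - u turns \<open>E_T u\<close> into y^2 = x^3 + 3u(2 - u)x + u(2u^2 -
  6u + 3). An isomorphism scales these coefficients by a^2 and a^3 with a = \<alpha>^2, so the two
  expressions are c4 and c6 up to constants.\<close>

lemma weierstrass_iso_E_T_iff: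
  fixes u v :: "'a::field"
  assumes two: "(2::'a) \<noteq> 0" and three: "(3::'a) \<noteq> 0"
  shows "weierstrass_iso (E_T u) (E_T v) \<longleftrightarrow>
    (\<exists>a. nz_square a \<and> v * (2 - v) = a ^ 2 * (u * (2 - u)) \<and>
       v * (2 * v ^ 2 - 6 * v + 3) = a ^ 3 * (u * (2 * u ^ 2 - 6 * u + 3)))"
    (is "?L \<longleftrightarrow> (\<exists>a. ?R a)")
proof -
  let ?C = "\<lambda>\<alpha> r. \<alpha> \<noteq> 0 \<and>
      r ^ 3 + 3 * v * r ^ 2 + 6 * v * r + 3 * v = 3 * u * \<alpha> ^ 6 \<and>
      \<alpha> ^ 2 * (3 * r ^ 2 + 6 * r * v + 6 * v) = 6 * u * \<alpha> ^ 6 \<and>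
      \<alpha> ^ 4 * (3 * r + 3 * v) = 3 * u * \<alpha> ^ 6"
  note coeffs = weierstrass_iso_E_T_coeffs[OF two, of u v]
  show ?thesis
  proof
    assume ?L
    then obtain \<alpha> r where C: "?C \<alpha> r" using coeffs by blast
    define a where "a = \<alpha> ^ 2"
    have a: "nz_square a" using C by (auto simp: a_def nz_square_def)
    have a0: "a \<noteq> 0" using C by (simp add: a_def)
    have a6: "\<alpha> ^ 6 = a ^ 3" "\<alpha> ^ 4 = a ^ 2" by (simp_all add: a_def flip: power_mult)
    \<comment> \<open>The coefficient of X^2 determines the translation \<open>r\<close>; the
      converse direction uses the same value.\<close>
    have "3 * (a ^ 2 * (r + v - u * a)) = 0" using C unfolding a6 by algebra
    hence r: "r = u * a - v" using a0 three
      by (metis eq_iff_diff_eq_0 eq_diff_eq mult_eq_0_iff power_not_zero)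
    have "3 * (a * (v * (2 - v) - a ^ 2 * (u * (2 - u)))) = 0"
      using C unfolding a6 a_def[symmetric] r by algebra
    hence A: "v * (2 - v) = a ^ 2 * (u * (2 - u))"
      using a0 three by (metis eq_iff_diff_eq_0 mult_eq_0_iff)
    have "v * (2 * v ^ 2 - 6 * v + 3) = a ^ 3 * (u * (2 * u ^ 2 - 6 * u + 3))"
      using C A unfolding a6 a_def[symmetric] r by algebra
    with a A show "\<exists>a. ?R a" by blast
  next
    assume "\<exists>a. ?R a"
    then obtain a where a: "?R a" by blast
    then obtain \<alpha> where \<alpha>: "a = \<alpha> ^ 2" "\<alpha> \<noteq> 0" by (auto simp: nz_square_def)
    have a6: "\<alpha> ^ 6 = a ^ 3" "\<alpha> ^ 4 = a ^ 2" by (simp_all add: \<alpha> flip: power_mult)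
    define r where "r = u * a - v"
    have "r ^ 3 + 3 * v * r ^ 2 + 6 * v * r + 3 * v = 3 * u * a ^ 3"
      using a unfolding r_def by algebra
    moreover have "a * (3 * r ^ 2 + 6 * r * v + 6 * v) = 6 * u * a ^ 3"
      using a unfolding r_def by algebra
    moreover have "a ^ 2 * (3 * r + 3 * v) = 3 * u * a ^ 3"
      unfolding r_def by algebra
    ultimately have "?C \<alpha> r" using \<alpha>(2) unfolding a6 \<alpha>(1)[symmetric] by blast
    thus ?L using coeffs by blast
  qed
qed

text \<open>Every class C contributes |C| times 1/|C|, that is 1. Classes can thus be counted from
  their sizes alone.\<close>

lemma real_card_quotient:
  assumes "equiv A r" "finite A"
  shows "real (card (A // r)) = (\<Sum>x\<in>A. 1 / real (card (r `` {x})))"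
proof -
  have fin: "finite (A // r)" "\<forall>C\<in>A // r. finite C"
    using assms finite_quotient[of A r] finite_equiv_class[of A r] by (auto simp: equiv_type)
  have disj: "\<forall>C\<in>A // r. \<forall>C'\<in>A // r. C \<noteq> C' \<longrightarrow> C \<inter> C' = {}"
    using quotient_disj[OF assms(1)] by blast
  have "(\<Sum>x\<in>A. 1 / real (card (r `` {x}))) = (\<Sum>x\<in>\<Union>(A // r). 1 / real (card (r `` {x})))"
    by (simp add: Union_quotient assms)
  also have "\<dots> = (\<Sum>C\<in>A // r. \<Sum>x\<in>C. 1 / real (card (r `` {x})))"
    using fin disj by (simp add: sum.Union_disjoint)
  also have "\<dots> = (\<Sum>C\<in>A // r. 1)"
  proof (rule sum.cong)
    fix C assume C: "C \<in> A // r"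
    hence "r `` {x} = C" if "x \<in> C" for x
      using that assms(1) by (metis Image_singleton_iff equiv_class_eq quotientE)
    moreover have "card C \<noteq> 0"
      using C fin assms(1) in_quotient_imp_non_empty by fastforce
    ultimately show "(\<Sum>x\<in>C. 1 / real (card (r `` {x}))) = 1"
      by simp
  qed simp
  finally show ?thesis by simp
qed

section \<open>Isomorphisms in terms of cube roots of the parameter\<close>

definition twist :: "'a::field \<Rightarrow> 'a" where
  "twist X = 3 * X * (X + 1) * (X - 2)"

text \<open>The involution of the projective line that exchanges 0 with 2 and -1 with infinity. In
  the field, division by zero makes \<open>fricke (-1)\<close> equal to 0.\<close>

definition fricke :: "'a::field \<Rightarrow> 'a" where
  "fricke X = (2 - X) / (1 + X)"

lemma twist_eq_0_iff:
  fixes X :: "'a::field"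
  assumes "(3::'a) \<noteq> 0"
  shows "twist X = 0 \<longleftrightarrow> X = 0 \<or> X = -1 \<or> X = 2"
  using assms by (auto simp: twist_def eq_neg_iff_add_eq_0)

lemma nz_square_mult_square_iff:
  assumes "b \<noteq> 0"
  shows "nz_square (a * b ^ 2) \<longleftrightarrow> nz_square a"
proof
  assume "nz_square (a * b ^ 2)"
  then obtain y where "a * b ^ 2 = y ^ 2" "a \<noteq> 0" by (auto simp: nz_square_def)
  hence "a = (y / b) ^ 2" using assms by (simp add: field_simps)
  thus "nz_square a" using \<open>a \<noteq> 0\<close> by (auto simp: nz_square_def)
next
  assume "nz_square a"
  thus "nz_square (a * b ^ 2)" using assms by (auto simp: nz_square_def simp flip: power_mult_distrib)
qed

text \<open>The change of variables has \<^term>\<open>\<alpha> ^ 2 = a\<close> and sends the point of \<^term>\<open>E_T u\<close> with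
  abscissa \<^term>\<open>v / a - u\<close> to abscissa 0. This abscissa is therefore a root of the 3-division
  polynomial x (x^3 + 4u(x^2 + 3x + 3)) of \<^term>\<open>E_T u\<close>, and the linear fractional transformation
  X = -x/(x + 3) turns the cubic factor into X^3 = 4u/(9 - 4u).\<close>

lemma scaled_invariants_imp_cube:
  fixes u v a :: "'a::field"
  assumes two: "(2::'a) \<noteq> 0" and three: "(3::'a) \<noteq> 0"
    and v0: "v \<noteq> 0" and u9: "4 * u \<noteq> 9" and uv: "u \<noteq> v"
    and a: "nz_square a" and P: "v * (2 - v) = a ^ 2 * (u * (2 - u))"
    and Q: "v * (2 * v ^ 2 - 6 * v + 3) = a ^ 3 * (u * (2 * u ^ 2 - 6 * u + 3))"
  shows "\<exists>X. X ^ 3 * (9 - 4 * u) = 4 * u \<and> (2 - X) ^ 3 * (9 - 4 * v) = 4 * v * (1 + X) ^ 3 \<and>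
           nz_square (twist X)"
proof -
  have a0: "a \<noteq> 0" using a by (auto simp: nz_square_def)
  define x where "x = v / a - u"
  have vx: "v = a * (x + u)" using a0 by (simp add: x_def)
  \<comment> \<open>x = 0 would mean v = a u, and \<open>P\<close> then forces a = 1 and u =
    v.\<close>
  have "x \<noteq> 0"
  proof
    assume "x = 0"
    hence "v = a * u" using vx by simp
    hence "v * (2 * (a - 1)) = 0" using P by algebra
    hence "a = 1" using v0 two by simp
    thus False using uv vx \<open>x = 0\<close> by simp
  qed
  have "a ^ 4 * (x * (x ^ 3 + 4 * u * (x ^ 2 + 3 * x + 3))) = 0"
  proof -
    \<comment> \<open>0 is a root of the 3-division polynomial of the short Weierstrass form, shifted back by v.\<close>
    have "v ^ 4 + 6 * (v * (2 - v)) * v ^ 2 + 4 * (v * (2 * v ^ 2 - 6 * v + 3)) * v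
        - 3 * (v * (2 - v)) ^ 2 = 0"
      by algebra
    thus ?thesis unfolding P Q unfolding vx by algebra
  qed
  hence x3: "x ^ 3 + 4 * u * (x ^ 2 + 3 * x + 3) = 0"
    using a0 \<open>x \<noteq> 0\<close> by simp
  \<comment> \<open>-3 is the pole of X = -x/(x + 3), and it is a root of the cubic only if 4u =
    9.\<close>
  have "x + 3 \<noteq> 0"
  proof
    assume "x + 3 = 0"
    hence "3 * (4 * u - 9) = 0" using x3 by algebra
    thus False using three u9 by (metis eq_iff_diff_eq_0 mult_eq_0_iff)
  qed
  have "x + 2 \<noteq> 0"
  proof
    assume "x + 2 = 0"
    hence "4 * (u - 2) = 0" "x = -2" using x3 by algebra+
    hence "u = 2" using two by (metis eq_iff_diff_eq_0 mult_2 mult_eq_0_iff numeral_Bit0)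
    thus False using vx v0 \<open>x = -2\<close> by simp
  qed
  define e where "e = x ^ 2 + 3 * x + 3"
  \<comment> \<open>\<open>x3\<close> is linear in \<open>u\<close>. Inserting its solution into
    \<open>P\<close> gives a = 3(x + 2)/(x(x + 3)), which is (1 + X)(X - 2)/(3X) in terms of
    X.\<close>
  have eu: "4 * e * u = - (x ^ 3)" using x3 unfolding e_def by algebra
  have "e \<noteq> 0" using eu \<open>x \<noteq> 0\<close> by auto
  have "a * (2 * (x + u) - a * (x ^ 2 + 2 * u * (x + 1))) = 0"
    using P unfolding vx by algebra
  hence *: "2 * (x + u) = a * (x ^ 2 + 2 * u * (x + 1))" using a0 by simp
  have ew: "4 * e * (x + u) = 3 * x * (x + 2) ^ 2"
    using eu e_def by algebra
  have "2 * e * (x ^ 2 + 2 * u * (x + 1)) = x ^ 2 * (x + 2) * (x + 3)"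
    using eu e_def by algebra
  with ew * have "x * (x + 2) * (3 * (x + 2) - a * x * (x + 3)) = 0"
    by algebra
  hence ax: "a * x * (x + 3) = 3 * (x + 2)"
    using \<open>x \<noteq> 0\<close> \<open>x + 2 \<noteq> 0\<close> by simp
  have "4 * e * v * (x + 3) = 9 * (x + 2) ^ 3"
    using ew ax vx by algebra
  hence v: "(x + 2) ^ 3 * (9 - 4 * v) = 4 * v"
    using e_def by algebra
  define X where "X = - x / (x + 3)"
  have X: "X * (x + 3) = - x" "(1 + X) * (x + 3) = 3" "(2 - X) * (x + 3) = 3 * (x + 2)"
    using \<open>x + 3 \<noteq> 0\<close> by (auto simp: X_def field_simps)
  have "(x + 3) ^ 3 * (X ^ 3 * (9 - 4 * u) - 4 * u) = 0"
    using X(1) x3 by algebra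
  hence 1: "X ^ 3 * (9 - 4 * u) = 4 * u" using \<open>x + 3 \<noteq> 0\<close> by simp
  have "(x + 3) ^ 3 * ((2 - X) ^ 3 * (9 - 4 * v) - 4 * v * (1 + X) ^ 3) =
      ((2 - X) * (x + 3)) ^ 3 * (9 - 4 * v) - 4 * v * ((1 + X) * (x + 3)) ^ 3"
    by algebra
  also have "\<dots> = 0"
    unfolding X(2,3) using v by algebra
  finally have 2: "(2 - X) ^ 3 * (9 - 4 * v) = 4 * v * (1 + X) ^ 3" using \<open>x + 3 \<noteq> 0\<close> by simp
  have "(x + 3) ^ 3 * (twist X - a * (3 * X) ^ 2) = 0"
    using X ax unfolding twist_def by algebra
  hence "twist X = a * (3 * X) ^ 2" using \<open>x + 3 \<noteq> 0\<close> by simp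
  moreover have "3 * X \<noteq> 0" using three \<open>x \<noteq> 0\<close> \<open>x + 3 \<noteq> 0\<close> by (simp add: X_def)
  ultimately have "nz_square (twist X)" using a nz_square_mult_square_iff by metis
  with 1 2 show ?thesis by blast
qed

text \<open>Converse of \<open>scaled_invariants_imp_cube\<close>. Both \<open>u\<close> and
  \<open>v\<close> are rational functions of \<open>X\<close>, and the scaling factor is the one
  found there; it differs from \<open>twist X\<close> by the square (3X)^2. Both identities are
  verified after clearing denominators.\<close>

lemma cube_imp_scaled_invariants:
  fixes u v X :: "'a::field"
  assumes two: "(2::'a) \<noteq> 0" and three: "(3::'a) \<noteq> 0"
    and u: "X ^ 3 * (9 - 4 * u) = 4 * u" and v: "(2 - X) ^ 3 * (9 - 4 * v) = 4 * v * (1 + X) ^ 3"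
    and sq: "nz_square (twist X)"
  shows "\<exists>a. nz_square a \<and> v * (2 - v) = a ^ 2 * (u * (2 - u)) \<and>
       v * (2 * v ^ 2 - 6 * v + 3) = a ^ 3 * (u * (2 * u ^ 2 - 6 * u + 3))"
proof -
  have "twist X \<noteq> 0" using sq by (auto simp: nz_square_def)
  hence X0: "X \<noteq> 0" and X1: "1 + X \<noteq> 0"
    using twist_eq_0_iff[OF three] by (auto simp: add_eq_0_iff)
  \<comment> \<open>The denominators of \<open>u\<close> and \<open>v\<close> are governed by 1 +
    X^3 = (1 + X)D and (1 + X)^3 + (2 - X)^3 = 9D.\<close>
  define D where "D = X ^ 2 - X + 1"
  have u': "4 * ((1 + X) * D) * u = 9 * X ^ 3" using u unfolding D_def by algebra
  have "9 * (4 * D * v - (2 - X) ^ 3) = 0" using v unfolding D_def by algebra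
  moreover have nine: "(9::'a) = 3 * 3" "(4::'a) = 2 * 2" "(16::'a) = 2 * 2 * (2 * 2)"
    "(64::'a) = 2 * 2 * (2 * 2) * (2 * 2)" "(144::'a) = 9 * 16" "(1728::'a) = 3 * 9 * 64" by simp_all
  ultimately have v': "4 * D * v = (2 - X) ^ 3" using three
    by (metis eq_iff_diff_eq_0 mult_eq_0_iff)
  have D: "D \<noteq> 0"
  proof
    assume "D = 0"
    hence "9 * X ^ 3 = 0" using u' by simp
    thus False using three X0 nine by (metis mult_eq_0_iff power_not_zero)
  qed
  have num: "(16::'a) \<noteq> 0" "(64::'a) \<noteq> 0" "(9::'a) \<noteq> 0" "(144::'a) \<noteq> 0" "(1728::'a) \<noteq> 0"
    using two three nine by (metis mult_eq_0_iff)+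
  define a where "a = (1 + X) * (X - 2) / (3 * X)"
  have a: "3 * X * a = (1 + X) * (X - 2)" using three X0 by (simp add: a_def)
  have "a * (3 * X) ^ 2 = twist X" using a unfolding twist_def by algebra
  hence "nz_square a" using sq nz_square_mult_square_iff[of "3 * X" a] three X0 by simp
  have 1: "16 * D ^ 2 * (v * (2 - v)) = X * (X ^ 2 + 2 * X + 4) * (2 - X) ^ 3"
    using v' unfolding D_def by algebra
  have 2: "16 * ((1 + X) * D) ^ 2 * (u * (2 - u)) = 9 * X ^ 3 * (8 - X ^ 3)"
    using u' unfolding D_def by algebra
  have "(3 * X) ^ 2 * (1 + X) ^ 2 * (16 * D ^ 2 * (v * (2 - v) - a ^ 2 * (u * (2 - u)))) =
      (3 * X) ^ 2 * (1 + X) ^ 2 * (16 * D ^ 2 * (v * (2 - v))) -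
      (3 * X * a) ^ 2 * (16 * ((1 + X) * D) ^ 2 * (u * (2 - u)))"
    by algebra
  also have "\<dots> = 0"
    unfolding 1 2 a by algebra
  finally have P: "v * (2 - v) = a ^ 2 * (u * (2 - u))"
    using X0 X1 D three num by simp
  have 3: "64 * D ^ 3 * (v * (2 * v ^ 2 - 6 * v + 3)) =
      (2 - X) ^ 3 * (2 * (2 - X) ^ 6 - 24 * (2 - X) ^ 3 * D + 48 * D ^ 2)"
    using v' by algebra
  have 4: "64 * ((1 + X) * D) ^ 3 * (u * (2 * u ^ 2 - 6 * u + 3)) =
      9 * X ^ 3 * (2 * (9 * X ^ 3) ^ 2 - 24 * (9 * X ^ 3) * ((1 + X) * D) + 48 * ((1 + X) * D) ^ 2)"
    using u' by algebra
  have "(3 * X) ^ 3 * (1 + X) ^ 3 * (64 * D ^ 3 * (v * (2 * v ^ 2 - 6 * v + 3) -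
      a ^ 3 * (u * (2 * u ^ 2 - 6 * u + 3)))) =
    (3 * X) ^ 3 * (1 + X) ^ 3 * (64 * D ^ 3 * (v * (2 * v ^ 2 - 6 * v + 3))) -
     (3 * X * a) ^ 3 * (64 * ((1 + X) * D) ^ 3 * (u * (2 * u ^ 2 - 6 * u + 3)))"
    by algebra
  also have "\<dots> = 0"
    unfolding 3 4 a unfolding D_def by algebra
  finally have Q: "v * (2 * v ^ 2 - 6 * v + 3) = a ^ 3 * (u * (2 * u ^ 2 - 6 * u + 3))"
    using X0 X1 D three num by simp
  show ?thesis using P Q \<open>nz_square a\<close> by blast
qed

text \<open>Inverse of c = 4u/(9 - 4u). The excluded values c = -1 and u = 9/4 correspond to
  infinity on the other side.\<close>

definition cubic_param :: "'a::field \<Rightarrow> 'a" where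
  "cubic_param c = 9 * c / (4 * (1 + c))"

text \<open>The zeros 0, -1, 2 of \<open>twist\<close> are left out: for them X^3 or
  \<open>fricke X\<close> is not an admissible parameter, and the default value of
  \<open>fricke (-1)\<close> never enters.\<close>

definition iso_class :: "'a::field \<Rightarrow> 'a set" where
  "iso_class c = insert c {fricke X ^ 3 | X. X ^ 3 = c \<and> nz_square (twist X)}"

lemma four_nonzero: "(2::'a::field) \<noteq> 0 \<Longrightarrow> (4::'a) \<noteq> 0"
  by (metis mult_eq_0_iff numeral_Bit0 mult_2)

lemma nine_nonzero: "(3::'a::field) \<noteq> 0 \<Longrightarrow> (9::'a) \<noteq> 0"
proof -
  assume "(3::'a) \<noteq> 0"
  moreover have "(9::'a) = 3 * 3" by simp
  ultimately show ?thesis by (metis mult_eq_0_iff)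
qed

lemma cubic_param_eq:
  fixes c :: "'a::field"
  assumes "(2::'a) \<noteq> 0" "c \<noteq> -1"
  shows "4 * cubic_param c * (1 + c) = 9 * c" "(9 - 4 * cubic_param c) * (1 + c) = 9"
proof -
  have "4 * (1 + c) \<noteq> 0"
    using assms four_nonzero by (auto simp: eq_neg_iff_add_eq_0 add.commute simp del: distrib_left_numeral)
  hence "cubic_param c * (4 * (1 + c)) = 9 * c"
    unfolding cubic_param_def by (metis nonzero_eq_divide_eq)
  thus *: "4 * cubic_param c * (1 + c) = 9 * c"
    by algebra
  show "(9 - 4 * cubic_param c) * (1 + c) = 9"
    using * by algebra
qed

lemma bij_cubic_param:
  assumes two: "(2::'a::field) \<noteq> 0" and three: "(3::'a) \<noteq> 0"
  shows "bij_betw cubic_param (UNIV - {0, -1 :: 'a}) (UNIV - {0, 9 / 4})"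
proof (rule bij_betwI[where g = "\<lambda>u. 4 * u / (9 - 4 * u)"])
  note four = four_nonzero[OF two] and nine = nine_nonzero[OF three]
  have "(36::'a) = 9 * 4" by simp
  hence n36: "(36::'a) \<noteq> 0" using nine four by (metis mult_eq_0_iff)
  show "cubic_param \<in> UNIV - {0, -1 :: 'a} \<rightarrow> UNIV - {0, 9 / 4}"
  proof
    fix c :: 'a assume c: "c \<in> UNIV - {0, -1}"
    note * = cubic_param_eq[OF two, of c]
    have "cubic_param c \<noteq> 0" using *(1) c nine by auto
    moreover have "9 - 4 * cubic_param c \<noteq> 0" using *(2) c nine by auto
    moreover have "9 - 4 * (9 / 4 :: 'a) = 0" using four by simp
    ultimately show "cubic_param c \<in> UNIV - {0, 9 / 4}" by (metis Diff_iff UNIV_I empty_iff insert_iff)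
  qed
  show "(\<lambda>u. 4 * u / (9 - 4 * u)) \<in> UNIV - {0, 9 / 4} \<rightarrow> UNIV - {0, -1 :: 'a}"
  proof
    fix u :: 'a assume u: "u \<in> UNIV - {0, 9 / 4}"
    have "9 - 4 * u \<noteq> 0"
    proof
      assume "9 - 4 * u = 0"
      hence "u = 9 / 4" using four by (simp add: field_simps)
      thus False using u by simp
    qed
    moreover from this have "4 * u / (9 - 4 * u) \<noteq> -1" using nine by (simp add: field_simps)
    ultimately show "4 * u / (9 - 4 * u) \<in> UNIV - {0, -1}" using u four by simp
  qed
  show "4 * cubic_param c / (9 - 4 * cubic_param c) = c" if "c \<in> UNIV - {0, -1 :: 'a}" for c
  proof -
    note * = cubic_param_eq[OF two, of c]
    have n: "9 - 4 * cubic_param c \<noteq> 0" using *(2) that nine by auto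
    have "9 * (4 * cubic_param c - c * (9 - 4 * cubic_param c)) = 0"
      using * that by algebra
    hence "4 * cubic_param c - c * (9 - 4 * cubic_param c) = 0"
      using nine by (metis mult_eq_0_iff)
    thus ?thesis using n by (simp add: field_simps)
  qed
  show "cubic_param (4 * u / (9 - 4 * u)) = u" if "u \<in> UNIV - {0, 9 / 4 :: 'a}" for u
  proof -
    have "9 - 4 * u \<noteq> 0"
    proof
      assume "9 - 4 * u = 0"
      hence "u = 9 / 4" using four by (simp add: field_simps)
      thus False using that by simp
    qed
    moreover from this have "1 + 4 * u / (9 - 4 * u) = 9 / (9 - 4 * u)" by (simp add: field_simps)
    moreover have "9 * (4 * u / w) / (4 * (9 / w)) = u" if "w \<noteq> 0" for w
      using that n36 by (simp add: field_simps)
    ultimately show ?thesis unfolding cubic_param_def by (simp add: n36)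
  qed
qed

text \<open>(2 - X)^3 + (1 + X)^3 = 9(X^2 - X + 1), and X^2 - X + 1 divides X^3 + 1.\<close>

lemma fricke_cube_ne_minus_one:
  fixes X :: "'a::field"
  assumes "(3::'a) \<noteq> 0" "X ^ 3 \<noteq> -1"
  shows "fricke X ^ 3 \<noteq> -1"
proof
  assume *: "fricke X ^ 3 = -1"
  have "1 + X \<noteq> 0" using assms(2) by (auto simp: add_eq_0_iff)
  hence "fricke X * (1 + X) = 2 - X" by (simp add: fricke_def)
  moreover have "(fricke X * (1 + X)) ^ 3 = - ((1 + X) ^ 3)" by (simp add: power_mult_distrib *)
  ultimately have "(3 * 3) * (X ^ 2 - X + 1) = 0" by algebra
  hence "X ^ 2 - X + 1 = 0" using assms by (metis mult_eq_0_iff)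
  hence "X ^ 3 = -1" by algebra
  with assms show False by simp
qed

lemma weierstrass_iso_cubic_param_iff:
  fixes c d :: "'a::field"
  assumes two: "(2::'a) \<noteq> 0" and three: "(3::'a) \<noteq> 0"
    and c: "c \<in> UNIV - {0, -1}" and d: "d \<in> UNIV - {0, -1}"
  shows "weierstrass_iso (E_T (cubic_param c)) (E_T (cubic_param d)) \<longleftrightarrow> d \<in> iso_class c"
proof -
  note nine = nine_nonzero[OF three]
  have pc: "4 * cubic_param c * (1 + c) = 9 * c" "(9 - 4 * cubic_param c) * (1 + c) = 9"
    and pd: "4 * cubic_param d * (1 + d) = 9 * d" "(9 - 4 * cubic_param d) * (1 + d) = 9"
    using cubic_param_eq[OF two] c d by blast+
  have ne: "1 + c \<noteq> 0" "1 + d \<noteq> 0" using c d by (auto simp: add_eq_0_iff)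
  \<comment> \<open>Multiplication by 1 + c turns 9 - 4u into 9 and 4u into 9c; likewise for
    \<open>d\<close>.\<close>
  have transfer: "X ^ 3 * (9 - 4 * cubic_param c) = 4 * cubic_param c \<longleftrightarrow> X ^ 3 = c"
    "(2 - X) ^ 3 * (9 - 4 * cubic_param d) = 4 * cubic_param d * (1 + X) ^ 3 \<longleftrightarrow> fricke X ^ 3 = d"
    if X: "nz_square (twist X)" for X
  proof -
    have "X ^ 3 * (9 - 4 * cubic_param c) = 4 * cubic_param c \<longleftrightarrow>
       X ^ 3 * ((9 - 4 * cubic_param c) * (1 + c)) = 4 * cubic_param c * (1 + c)"
      unfolding mult_right_cancel[OF ne(1), symmetric, of "X ^ 3 * (9 - 4 * cubic_param c)"]
      by (simp only: mult.assoc)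
    also have "\<dots> \<longleftrightarrow> X ^ 3 = c"
      unfolding pc using nine by (simp add: mult.commute)
    finally show "X ^ 3 * (9 - 4 * cubic_param c) = 4 * cubic_param c \<longleftrightarrow> X ^ 3 = c" .
    have "1 + X \<noteq> 0" using X three by (auto simp: nz_square_def twist_eq_0_iff eq_neg_iff_add_eq_0 add.commute)
    have "(2 - X) ^ 3 * (9 - 4 * cubic_param d) = 4 * cubic_param d * (1 + X) ^ 3 \<longleftrightarrow>
      (2 - X) ^ 3 * ((9 - 4 * cubic_param d) * (1 + d)) = (1 + X) ^ 3 * (4 * cubic_param d * (1 + d))"
      unfolding mult_right_cancel[OF ne(2), symmetric, of "(2 - X) ^ 3 * (9 - 4 * cubic_param d)"]
      by (simp only: mult.assoc mult.left_commute[of "(1 + X) ^ 3"] mult.commute[of "(1 + X) ^ 3"])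
    also have "\<dots> \<longleftrightarrow> (2 - X) ^ 3 = (1 + X) ^ 3 * d"
      unfolding pd using nine by (simp add: mult.commute mult.left_commute)
    also have "\<dots> \<longleftrightarrow> fricke X ^ 3 = d"
      using \<open>1 + X \<noteq> 0\<close>
      by (simp add: fricke_def power_divide nonzero_divide_eq_eq mult.commute)
    finally show "(2 - X) ^ 3 * (9 - 4 * cubic_param d) = 4 * cubic_param d * (1 + X) ^ 3 \<longleftrightarrow>
      fricke X ^ 3 = d" .
  qed
  note bij = bij_cubic_param[OF two three]
  show ?thesis
  proof (cases "c = d")
    case True
    have "nz_square (1::'a)" by (auto simp: nz_square_def intro: exI[of _ 1])
    thus ?thesis using True
      unfolding weierstrass_iso_E_T_iff[OF two three] iso_class_def by (auto intro!: exI[of _ 1])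
  next
    case False
    have "cubic_param c \<noteq> cubic_param d"
      using False c d bij by (meson bij_betw_imp_inj_on inj_onD)
    moreover have "cubic_param d \<noteq> 0" using pd(1) d nine by auto
    moreover have "4 * cubic_param c \<noteq> 9" using pc(2) c nine by auto
    ultimately have "weierstrass_iso (E_T (cubic_param c)) (E_T (cubic_param d)) \<longleftrightarrow>
        (\<exists>X. X ^ 3 * (9 - 4 * cubic_param c) = 4 * cubic_param c \<and>
          (2 - X) ^ 3 * (9 - 4 * cubic_param d) = 4 * cubic_param d * (1 + X) ^ 3 \<and> nz_square (twist X))"
      unfolding weierstrass_iso_E_T_iff[OF two three]
      using scaled_invariants_imp_cube[OF two three] cube_imp_scaled_invariants[OF two three] by blast
    thus ?thesis using False transfer unfolding iso_class_def by auto
  qed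
qed

lemma iso_class_subset:
  fixes c :: "'a::field"
  assumes "(2::'a) \<noteq> 0" and three: "(3::'a) \<noteq> 0" and c: "c \<in> UNIV - {0, -1}"
  shows "iso_class c \<subseteq> UNIV - {0, -1}"
proof -
  have "fricke X \<noteq> 0" if "nz_square (twist X)" for X :: 'a
  proof -
    have "twist X \<noteq> 0" using that by (auto simp: nz_square_def)
    thus ?thesis using three
      by (auto simp: fricke_def twist_eq_0_iff eq_neg_iff_add_eq_0 add.commute)
  qed
  thus ?thesis
    using c fricke_cube_ne_minus_one[OF three] by (auto simp: iso_class_def)
qed

section \<open>The number of classes as a weighted sum over the parameters\<close>

text \<open>By the criterion on invariants, the three laws hold with the scaling factors 1, 1/a and
  a b, all nonzero squares.\<close>

lemma equiv_weierstrass_iso_E_T_family: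
  assumes two: "(2::'a::field) \<noteq> 0" and three: "(3::'a) \<noteq> 0"
  shows "equiv (E_T_family :: 'a weierstrass set)
    {(E, E'). E \<in> E_T_family \<and> E' \<in> E_T_family \<and> weierstrass_iso E E'}"
proof (rule equivI)
  note iff = weierstrass_iso_E_T_iff[OF two three]
  show "{(E, E'). E \<in> E_T_family \<and> E' \<in> E_T_family \<and> weierstrass_iso E E'}
      \<subseteq> E_T_family \<times> (E_T_family :: 'a weierstrass set)" by blast
  have "nz_square (1::'a)" by (auto simp: nz_square_def intro: exI[of _ 1])
  hence "weierstrass_iso (E_T u) (E_T u)" for u :: 'a
    unfolding iff by (intro exI[of _ 1]) simp
  thus "refl_on E_T_family {(E, E'). E \<in> E_T_family \<and> E' \<in> (E_T_family :: 'a weierstrass set) \<and>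
      weierstrass_iso E E'}"
    by (auto simp: refl_on_def E_T_family_def)
  have "weierstrass_iso (E_T v) (E_T u)" if iso: "weierstrass_iso (E_T u) (E_T v)" for u v :: 'a
  proof -
    obtain a where a: "nz_square a" "v * (2 - v) = a ^ 2 * (u * (2 - u))"
      "v * (2 * v ^ 2 - 6 * v + 3) = a ^ 3 * (u * (2 * u ^ 2 - 6 * u + 3))"
      using iso unfolding iff by blast
    have "nz_square (1 / a)" using a(1) by (auto simp: nz_square_def simp flip: power_one_over)
    moreover have "a \<noteq> 0" using a(1) by (simp add: nz_square_def)
    ultimately show ?thesis
      unfolding iff a(2,3) by (intro exI[of _ "1 / a"]) (simp add: power_one_over)
  qed
  thus "sym {(E, E'). E \<in> E_T_family \<and> E' \<in> (E_T_family :: 'a weierstrass set) \<and> weierstrass_iso E E'}"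
    by (simp add: sym_def E_T_family_def) fast
  have "weierstrass_iso (E_T u) (E_T w)"
    if iso: "weierstrass_iso (E_T u) (E_T v)" "weierstrass_iso (E_T v) (E_T w)" for u v w :: 'a
  proof -
    obtain a where a: "nz_square a" "v * (2 - v) = a ^ 2 * (u * (2 - u))"
      "v * (2 * v ^ 2 - 6 * v + 3) = a ^ 3 * (u * (2 * u ^ 2 - 6 * u + 3))"
      using iso(1) unfolding iff by blast
    obtain b where b: "nz_square b" "w * (2 - w) = b ^ 2 * (v * (2 - v))"
      "w * (2 * w ^ 2 - 6 * w + 3) = b ^ 3 * (v * (2 * v ^ 2 - 6 * v + 3))"
      using iso(2) unfolding iff by blast
    have "nz_square (a * b)"
      using a(1) b(1) by (auto simp: nz_square_def simp flip: power_mult_distrib)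
    thus ?thesis
      unfolding iff b(2,3) a(2,3)
      by (intro exI[of _ "a * b"]) (simp add: power_mult_distrib mult_ac)
  qed
  thus "trans {(E, E'). E \<in> E_T_family \<and> E' \<in> (E_T_family :: 'a weierstrass set) \<and> weierstrass_iso E E'}"
    by (intro transI) (auto simp: E_T_family_def)
qed

lemma I_T_eq_sum_iso_class:
  assumes two: "(2::'a::finite_field) \<noteq> 0" and three: "(3::'a) \<noteq> 0"
  shows "real (I_T TYPE('a)) = (\<Sum>c\<in>UNIV - {0, -1 :: 'a}. 1 / real (card (iso_class c)))"
proof -
  define r where "r = {(E, E'). E \<in> E_T_family \<and> E' \<in> (E_T_family :: 'a weierstrass set) \<and> weierstrass_iso E E'}"
  define g where "g = (\<lambda>c::'a. E_T (cubic_param c))"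
  have "bij_betw E_T (UNIV - {0, 9 / 4 :: 'a}) E_T_family"
    using three by (auto simp: bij_betw_def E_T_family_def inj_on_def E_T_def)
  hence bij: "bij_betw g (UNIV - {0, -1}) E_T_family"
    using bij_betw_trans[OF bij_cubic_param[OF two three]] by (auto simp: g_def o_def)
  have "real (I_T TYPE('a)) = (\<Sum>E\<in>E_T_family. 1 / real (card (r `` {E})))"
    unfolding I_T_def r_def
    by (rule real_card_quotient[OF equiv_weierstrass_iso_E_T_family[OF two three]])
      (simp add: E_T_family_def)
  also have "\<dots> = (\<Sum>c\<in>UNIV - {0, -1 :: 'a}. 1 / real (card (r `` {g c})))"
    by (rule sum.reindex_bij_betw[OF bij, symmetric])
  also have "\<dots> = (\<Sum>c\<in>UNIV - {0, -1 :: 'a}. 1 / real (card (iso_class c)))"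
  proof (rule sum.cong)
    fix c :: 'a assume c: "c \<in> UNIV - {0, -1}"
    have "g c \<in> E_T_family"
      using bij c by (rule bij_betwE[rule_format])
    hence "r `` {g c} = {E \<in> g ` (UNIV - {0, -1}). weierstrass_iso (g c) E}"
      unfolding bij_betw_imp_surj_on[OF bij] by (simp add: r_def)
    also have "\<dots> = g ` {d \<in> UNIV - {0, -1}. weierstrass_iso (g c) (g d)}"
      by blast
    also have "{d \<in> UNIV - {0, -1}. weierstrass_iso (g c) (g d)} = iso_class c"
      using weierstrass_iso_cubic_param_iff[OF two three c] iso_class_subset[OF two three c]
      by (auto simp: g_def)
    finally have "r `` {g c} = g ` iso_class c" .
    moreover have "inj_on g (iso_class c)"
      using bij iso_class_subset[OF two three c] by (meson bij_betw_imp_inj_on inj_on_subset)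
    ultimately show "1 / real (card (r `` {g c})) = 1 / real (card (iso_class c))"
      by (simp add: card_image)
  qed simp
  finally show ?thesis .
qed

lemma card_square_roots:
  fixes a :: "'a::{field, finite}"
  assumes "(2::'a) \<noteq> 0"
  shows "card {y. y ^ 2 = a} = (if a = 0 then 1 else if nz_square a then 2 else 0)"
proof (cases "nz_square a")
  case True
  then obtain y where y: "a = y ^ 2" "y \<noteq> 0" by (auto simp: nz_square_def)
  have "{z. z ^ 2 = a} = {y, - y}" by (auto simp: y power2_eq_iff)
  moreover have "y \<noteq> - y"
  proof
    assume "y = - y"
    hence "2 * y = 0" by (metis eq_neg_iff_add_eq_0 mult_2)
    thus False using assms y by simp
  qed
  ultimately show ?thesis using True by (auto simp: nz_square_def)
next
  case False
  hence "{z. z ^ 2 = a} = (if a = 0 then {0} else {})" by (auto simp: nz_square_def)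
  thus ?thesis using False by simp
qed

section \<open>Squares in finite fields\<close>

text \<open>Euler's criterion by counting: the nonzero squares are among the at most
  \<open>m\<close> solutions of x^m = 1, and there are \<open>m\<close> of them because squaring is
  two-to-one on the 2m nonzero elements.\<close>

lemma nz_square_iff_power:
  fixes a :: "'a::finite_field"
  assumes two: "(2::'a) \<noteq> 0" and card: "CARD('a) = 2 * m + 1" and "a \<noteq> 0"
  shows "nz_square a \<longleftrightarrow> a ^ m = 1"
proof -
  have power: "x ^ (2 * m) = 1" if "x \<noteq> 0" for x :: 'a
    using finite_field_power_card_eq_same[of x] that card by simp
  have "2 \<le> CARD('a)" using card_mono[of UNIV "{0, 1 :: 'a}"] by simp
  hence "m > 0" using card by simp
  define p :: "'a poly" where "p = monom 1 m + [:-1:]"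
  have deg: "degree p = m"
    using \<open>m > 0\<close> unfolding p_def
    by (subst degree_add_eq_left) (simp_all add: degree_monom_eq)
  hence "p \<noteq> 0" using \<open>m > 0\<close> by auto
  have roots: "{x. poly p x = 0} = {x. x ^ m = 1}" by (simp add: p_def poly_monom)
  have "{x. nz_square x} \<subseteq> {x :: 'a. x ^ m = 1}"
    using power by (auto simp: nz_square_def simp flip: power_mult)
  moreover have "card {x :: 'a. x ^ m = 1} \<le> card {x :: 'a. nz_square x}"
  proof -
    have le: "card {x :: 'a. x ^ m = 1} \<le> m"
      using card_poly_roots_bound[OF \<open>p \<noteq> 0\<close>] deg by (simp add: roots)
    have "2 * m = (\<Sum>b\<in>{x :: 'a. nz_square x}. card {y. y ^ 2 = b})"
    proof -
      have "2 * m = card (UNIV - {0 :: 'a})" using card by (simp add: card_Diff_singleton)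
      also have "UNIV - {0 :: 'a} = (\<Union>b\<in>{x. nz_square x}. {y. y ^ 2 = b})"
        by (auto simp: nz_square_def)
      also have "card \<dots> = (\<Sum>b\<in>{x :: 'a. nz_square x}. card {y. y ^ 2 = b})"
        by (rule card_UN_disjoint) auto
      finally show ?thesis .
    qed
    also have "\<dots> = (\<Sum>b\<in>{x :: 'a. nz_square x}. 2)"
      unfolding card_square_roots[OF two] by (intro sum.cong refl) (auto simp: nz_square_def)
    finally show ?thesis using le by simp
  qed
  ultimately have "{x. nz_square x} = {x :: 'a. x ^ m = 1}"
    by (intro card_seteq) simp_all
  thus ?thesis by blast
qed

lemma nz_square_mult_iff:
  fixes a b :: "'a::finite_field"
  assumes two: "(2::'a) \<noteq> 0" and card: "CARD('a) = 2 * m + 1" and "a \<noteq> 0" "b \<noteq> 0"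
  shows "nz_square (a * b) \<longleftrightarrow> (nz_square a \<longleftrightarrow> nz_square b)"
proof -
  have "a ^ m = 1 \<or> a ^ m = -1" if "a \<noteq> 0" for a :: 'a
  proof -
    have "(a ^ m) ^ 2 = 1"
      using finite_field_power_card_eq_same[of a] that card by (simp flip: power_mult add: mult.commute)
    thus ?thesis by (simp add: power2_eq_1_iff)
  qed
  moreover have "(-1 :: 'a) \<noteq> 1" using two by (metis eq_neg_iff_add_eq_0 one_add_one)
  ultimately have "a ^ m * b ^ m = 1 \<longleftrightarrow> (a ^ m = 1 \<longleftrightarrow> b ^ m = 1)"
    using assms(3,4) by (metis mult_1 mult_minus1 minus_minus mult_1_right)
  thus ?thesis
    using assms(3,4) by (simp add: nz_square_iff_power[OF two card] power_mult_distrib)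
qed

lemma nz_square_minus_one_iff:
  assumes two: "(2::'a::finite_field) \<noteq> 0" and card: "CARD('a) = 2 * m + 1"
  shows "nz_square (-1 :: 'a) \<longleftrightarrow> even m"
proof -
  have "(-1 :: 'a) \<noteq> 1" using two by (metis eq_neg_iff_add_eq_0 one_add_one)
  thus ?thesis
    by (subst nz_square_iff_power[OF two card]) (auto simp: minus_one_power_iff)
qed

text \<open>For i^2 = -1 one has (1 + i)^2 = 2i, so 2 is a square iff i is, and i^(2k) =
  (-1)^k.\<close>

lemma nz_square_two_iff:
  assumes two: "(2::'a::finite_field) \<noteq> 0" and card: "CARD('a) = 4 * k + 1"
  shows "nz_square (2 :: 'a) \<longleftrightarrow> even k"
proof -
  have card': "CARD('a) = 2 * (2 * k) + 1" using card by simp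
  have ne: "(-1 :: 'a) \<noteq> 1" using two by (metis eq_neg_iff_add_eq_0 one_add_one)
  have "nz_square (-1 :: 'a)" by (simp add: nz_square_minus_one_iff[OF two card'])
  then obtain i :: 'a where i: "i ^ 2 = -1" by (auto simp: nz_square_def)
  have "i \<noteq> 0" using i by auto
  have "1 + i \<noteq> 0" using i ne by (auto simp: add_eq_0_iff)
  have "1 * (1 + i) ^ 2 = 2 * i" using i by (simp add: power2_sum)
  moreover have "nz_square (1 :: 'a)" by (auto simp: nz_square_def intro: exI[of _ 1])
  ultimately have "nz_square (2 * i)"
    using nz_square_mult_square_iff[OF \<open>1 + i \<noteq> 0\<close>, of 1] by simp
  hence "nz_square (2 :: 'a) \<longleftrightarrow> nz_square i"
    using nz_square_mult_iff[OF two card' two \<open>i \<noteq> 0\<close>] by simp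
  also have "\<dots> \<longleftrightarrow> even k"
    using nz_square_iff_power[OF two card' \<open>i \<noteq> 0\<close>] ne i
    by (auto simp: power_mult minus_one_power_iff)
  finally show ?thesis .
qed

lemma two_three_nonzero:
  assumes "CHAR('a::field) \<ge> 5"
  shows "(2::'a) \<noteq> 0" "(3::'a) \<noteq> 0"
proof -
  have "\<not> CHAR('a) dvd 2" "\<not> CHAR('a) dvd 3" using assms by (auto dest!: dvd_imp_le)
  hence "of_nat 2 \<noteq> (0::'a)" "of_nat 3 \<noteq> (0::'a)" unfolding of_nat_eq_0_iff_char_dvd by blast+
  thus "(2::'a) \<noteq> 0" "(3::'a) \<noteq> 0" by simp_all
qed

section \<open>Points on the Legendre curve\<close>

lemma sum_twist_roots:
  assumes two: "(2::'a::finite_field) \<noteq> 0" and three: "(3::'a) \<noteq> 0"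
  shows "(\<Sum>X\<in>(UNIV :: 'a set). card {y. y ^ 2 = twist X}) = 3 + 2 * card {X :: 'a. nz_square (twist X)}"
proof -
  have ne: "(2 :: 'a) \<noteq> -1" using three by (auto simp: eq_neg_iff_add_eq_0)
  have "(\<Sum>X\<in>(UNIV :: 'a set). card {y. y ^ 2 = twist X}) =
      (\<Sum>X\<in>UNIV. of_bool (X \<in> {0, -1, 2 :: 'a}) + 2 * of_bool (nz_square (twist X)))"
  proof (rule sum.cong)
    fix X :: 'a
    show "card {y. y ^ 2 = twist X} = of_bool (X \<in> {0, -1, 2}) + 2 * of_bool (nz_square (twist X))"
      unfolding card_square_roots[OF two] using twist_eq_0_iff[OF three, of X]
      by (auto simp: nz_square_def)
  qed simp
  also have "\<dots> = card {0, -1, 2 :: 'a} + 2 * card {X :: 'a. nz_square (twist X)}"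
    unfolding sum.distrib sum_distrib_left[symmetric]
    by (simp only: sum_of_bool_eq finite Int_UNIV_left Collect_mem_eq of_nat_id)
  also have "card {0, -1, 2 :: 'a} = 3" using ne two by (simp add: neg_eq_iff_add_eq_0)
  finally show ?thesis .
qed

text \<open>X = 3x - 1 carries the roots 0, 1, 1/3 to -1, 2, 0 and changes the cubic by the square
  factor 81. The 4 consists of the three roots and the point at infinity.\<close>

lemma N2_eq:
  assumes two: "(2::'a::finite_field) \<noteq> 0" and three: "(3::'a) \<noteq> 0"
  shows "N2 TYPE('a) = 4 + 2 * card {X :: 'a. nz_square (twist X)}"
proof -
  have bij: "bij (\<lambda>x::'a. 3 * x - 1)"
    by (rule bij_betwI[where g = "\<lambda>x. (x + 1) / 3"]) (use three in \<open>auto simp: field_simps\<close>)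
  have eq: "card {y. y ^ 2 = x * (x - 1) * (x - 1 / 3)} = card {y. y ^ 2 = twist (3 * x - 1)}" for x :: 'a
  proof -
    have "twist (3 * x - 1) = (x * (x - 1) * (x - 1 / 3)) * (3 ^ 2) ^ 2"
      using three by (simp add: twist_def field_simps power2_eq_square)
    moreover have "(3 ^ 2 :: 'a) \<noteq> 0" using three by (metis power_not_zero)
    ultimately show ?thesis
      unfolding card_square_roots[OF two] by (simp only: nz_square_mult_square_iff mult_eq_0_iff power_not_zero simp_thms)
  qed
  have "N2 TYPE('a) = Suc (card (affine_points (legendre (1 / 3 :: 'a))))"
    unfolding N2_def rational_points_def by (subst card_insert_disjoint) (auto simp: card_image)
  also have "affine_points (legendre (1 / 3 :: 'a)) =
      Sigma UNIV (\<lambda>x. {y. y ^ 2 = x * (x - 1) * (x - 1 / 3)})"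
    unfolding affine_points_legendre by auto
  also have "card \<dots> = (\<Sum>x\<in>(UNIV :: 'a set). card {y. y ^ 2 = twist (3 * x - 1)})"
    by (subst card_SigmaI) (auto simp: eq)
  also have "\<dots> = (\<Sum>X\<in>(UNIV :: 'a set). card {y. y ^ 2 = twist X})"
    by (rule sum.reindex_bij_betw[OF bij])
  finally show ?thesis unfolding sum_twist_roots[OF two three] by simp
qed

section \<open>The case q = 2 (mod 3)\<close>

lemma I_T_eq_if_card_mod_3_eq_2:
  assumes two: "(2::'a::finite_field) \<noteq> 0" and three: "(3::'a) \<noteq> 0"
    and card: "CARD('a) = 3 * k + 2"
  shows "real (I_T TYPE('a)) = real CARD('a) - 1 - real (N2 TYPE('a)) / 4"
proof -
  \<comment> \<open>The field has no nontrivial cube root of unity, as z = z^q = z^(3k + 2) =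
    z^2.\<close>
  have root1: "z = 1" if "z ^ 3 = 1" for z :: 'a
  proof -
    have "z = z ^ (3 * k + 2)" using finite_field_power_card_eq_same[of z] card by simp
    also have "\<dots> = z ^ 2" by (simp add: power_add power_mult that power2_eq_square)
    finally show ?thesis using that by (auto simp: power2_eq_square)
  qed
  have inj: "inj (\<lambda>x::'a. x ^ 3)"
  proof (rule injI)
    fix x y :: 'a assume eq: "x ^ 3 = y ^ 3"
    show "x = y"
    proof (cases "y = 0")
      case False
      hence "(x / y) ^ 3 = 1" using eq by (simp add: power_divide)
      hence "x / y = 1" by (rule root1)
      thus ?thesis using False by simp
    qed (use eq in auto)
  qed
  \<comment> \<open>A square root s of -3 would give the cube root of unity (s - 1)/2.\<close>
  have nonsquare: "\<not> nz_square (-3 :: 'a)"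
  proof
    assume "nz_square (-3 :: 'a)"
    then obtain s :: 'a where s: "s ^ 2 = -3" by (auto simp: nz_square_def)
    have "(s - 1) ^ 3 = 8" using s by algebra
    hence "(s - 1) ^ 3 = 2 ^ 3" by simp
    hence "((s - 1) / 2) ^ 3 = 1" using two by (metis divide_self power_divide power_not_zero)
    hence "(s - 1) / 2 = 1" by (rule root1)
    hence "s = 3" using two by (simp add: field_simps)
    hence "(2 * 2 * 3 :: 'a) = 0" using s by simp
    thus False using two three by (metis mult_eq_0_iff)
  qed
  \<comment> \<open>At a fixed point of \<open>fricke\<close> the twist is -3 times a square, hence
    not a square. The second element of a class therefore really differs from the first.\<close>
  have not_fixed: "fricke X \<noteq> X" if sq: "nz_square (twist X)" for X :: 'a
  proof
    assume "fricke X = X"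
    have X: "X \<noteq> 0" "1 + X \<noteq> 0" "X - 2 \<noteq> 0"
      using sq twist_eq_0_iff[OF three, of X]
      by (auto simp: nz_square_def eq_neg_iff_add_eq_0 add.commute)
    hence "2 - X = X * (1 + X)" using \<open>fricke X = X\<close> by (simp add: fricke_def field_simps)
    hence "twist X = (-3) * (X - 2) ^ 2" unfolding twist_def by algebra
    thus False using sq nonsquare nz_square_mult_square_iff[OF X(3)] by metis
  qed
  have card_class: "card (iso_class (X ^ 3)) = (if nz_square (twist X) then 2 else 1)" for X :: 'a
  proof -
    have "iso_class (X ^ 3) = insert (X ^ 3) (if nz_square (twist X) then {fricke X ^ 3} else {})"
      using injD[OF inj] by (auto simp: iso_class_def)
    moreover have "fricke X ^ 3 \<noteq> X ^ 3" if "nz_square (twist X)"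
      using not_fixed[OF that] injD[OF inj] by blast
    ultimately show ?thesis by auto
  qed
  have bij: "bij_betw (\<lambda>x::'a. x ^ 3) (UNIV - {0, -1}) (UNIV - {0, -1})"
  proof -
    have "bij (\<lambda>x::'a. x ^ 3)"
      using inj by (simp add: bij_def finite_UNIV_inj_surj)
    from bij_betw_DiffI[OF this, of "{0, -1}" "{0, -1}"] show ?thesis
      by (simp add: bij_betw_def)
  qed
  have ne: "(-1 :: 'a) \<noteq> 0" by simp
  have "real (I_T TYPE('a)) = (\<Sum>X\<in>UNIV - {0, -1 :: 'a}. 1 / real (card (iso_class (X ^ 3))))"
    unfolding I_T_eq_sum_iso_class[OF two three] by (rule sum.reindex_bij_betw[OF bij, symmetric])
  also have "\<dots> = (\<Sum>X\<in>UNIV - {0, -1 :: 'a}. 1 - of_bool (nz_square (twist X)) / 2)"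
    by (intro sum.cong) (auto simp: card_class)
  also have "\<dots> = real (card (UNIV - {0, -1 :: 'a})) -
      (\<Sum>X\<in>UNIV - {0, -1 :: 'a}. of_bool (nz_square (twist X))) / 2"
    unfolding sum_subtractf sum_divide_distrib by simp
  also have "(\<Sum>X\<in>UNIV - {0, -1 :: 'a}. of_bool (nz_square (twist X))) =
      real (card {X \<in> UNIV - {0, -1 :: 'a}. nz_square (twist X)})"
    by (simp add: sum_of_bool_eq Int_def)
  also have "{X \<in> UNIV - {0, -1 :: 'a}. nz_square (twist X)} = {X. nz_square (twist X)}"
    using twist_eq_0_iff[OF three] by (auto simp: nz_square_def)
  also have "card (UNIV - {0, -1 :: 'a}) = CARD('a) - 2"
    using ne by (subst card_Diff_subset) auto
  finally show ?thesis
    using card unfolding N2_eq[OF two three] by (simp add: field_simps)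
qed

section \<open>The case q = 1 (mod 3)\<close>

text \<open>The excluded X are the singular ones (X = 0 and X^3 = -1) and those over j = 0
  (X^3 = 8) and over j = 1728 (X^6 + 20 X^3 = 8).\<close>

definition generic :: "'a::field set" where
  "generic = {X. X \<noteq> 0 \<and> X ^ 3 \<noteq> -1 \<and> X ^ 3 \<noteq> 8 \<and> X ^ 6 + 20 * X ^ 3 - 8 \<noteq> 0}"

text \<open>This and \<open>twist_rotate_fricke\<close> describe modulo squares how the three twists
  over X^3 determine those over \<open>fricke X ^ 3\<close>.\<close>

lemma twist_fricke:
  assumes "1 + X \<noteq> (0::'a::field)"
  shows "twist (fricke X) = twist X * (3 / (1 + X) ^ 2) ^ 2"
proof -
  define Y where "Y = fricke X"
  have Y: "Y * (1 + X) = 2 - X" using assms by (simp add: Y_def fricke_def)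
  have "(1 + X) ^ 4 * twist Y = 3 * ((1 + X) * (Y * (1 + X)) * (Y * (1 + X) + (1 + X)) * (Y * (1 + X) - 2 * (1 + X)))"
    unfolding twist_def by algebra
  also have "\<dots> = 9 * twist X" unfolding Y twist_def by algebra
  finally have "twist Y * (1 + X) ^ 4 = twist X * 9" by (simp add: mult.commute)
  hence "twist Y = twist X * 9 / (1 + X) ^ 4"
    using assms by (simp add: nonzero_eq_divide_eq)
  thus ?thesis by (simp add: Y_def power_divide flip: power_mult)
qed

text \<open>With F for \<open>fricke\<close>, F(\<zeta> F(X))^3 = F(\<zeta>^2 X)^3. Passing from
  F(X)^3 by way of \<zeta> F(X) amounts to returning to X^3 and going on by way of \<zeta>^2 X, so
  the twists multiply. Any root \<zeta> of the quadratic is allowed, hence also its square.\<close>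

lemma twist_rotate_fricke:
  fixes \<zeta> X :: "'a::field"
  assumes \<zeta>: "\<zeta> ^ 2 + \<zeta> + 1 = 0" and X: "1 + X \<noteq> 0" "X \<noteq> 0"
  shows "twist (\<zeta> * fricke X) = twist X * twist (\<zeta> ^ 2 * X) * (\<zeta> ^ 2 / (X * (1 + X) ^ 2)) ^ 2"
proof -
  define Y where "Y = fricke X"
  have Y: "Y * (1 + X) = 2 - X" using X by (simp add: Y_def fricke_def)
  have "X ^ 2 * (1 + X) ^ 4 * twist (\<zeta> * Y) = 3 * X ^ 2 * ((1 + X) * (\<zeta> * (Y * (1 + X))) *
      (\<zeta> * (Y * (1 + X)) + (1 + X)) * (\<zeta> * (Y * (1 + X)) - 2 * (1 + X)))"
    unfolding twist_def by algebra
  also have "\<dots> = twist X * twist (\<zeta> ^ 2 * X) * \<zeta> ^ 4"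
    unfolding Y twist_def using \<zeta> by algebra
  finally have "twist (\<zeta> * Y) * (X ^ 2 * (1 + X) ^ 4) = twist X * twist (\<zeta> ^ 2 * X) * \<zeta> ^ 4"
    by (simp add: mult.commute)
  hence "twist (\<zeta> * Y) = twist X * twist (\<zeta> ^ 2 * X) * \<zeta> ^ 4 / (X ^ 2 * (1 + X) ^ 4)"
    using X by (simp add: nonzero_eq_divide_eq)
  thus ?thesis by (simp add: Y_def power_divide power_mult_distrib flip: power_mult)
qed

lemma fricke_fricke:
  assumes "(3::'a::field) \<noteq> 0" "1 + X \<noteq> (0::'a)"
  shows "fricke (fricke X) = X"
proof -
  have "2 - fricke X = 3 * X / (1 + X)" "1 + fricke X = 3 / (1 + X)"
    using assms(2) by (simp_all add: fricke_def field_simps)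
  thus ?thesis using assms by (simp add: fricke_def[of "fricke X"])
qed

text \<open>The first factor expresses \<open>fricke X = X\<close>; the other two divide X^3 - 8 and
  X^3 + 1.\<close>

lemma fricke_cube_eq_cube:
  assumes "1 + X \<noteq> (0::'a::field)"
  shows "fricke X ^ 3 = X ^ 3 \<longleftrightarrow> (X ^ 2 + 2 * X - 2) * (X ^ 2 + 2 * X + 4) * (X ^ 2 - X + 1) = 0"
proof -
  have "fricke X ^ 3 = X ^ 3 \<longleftrightarrow> (2 - X) ^ 3 = X ^ 3 * (1 + X) ^ 3"
    using assms by (simp add: fricke_def power_divide nonzero_divide_eq_eq)
  also have "\<dots> \<longleftrightarrow> X ^ 3 * (1 + X) ^ 3 - (2 - X) ^ 3 = 0" by auto
  also have "X ^ 3 * (1 + X) ^ 3 - (2 - X) ^ 3 = (X ^ 2 + 2 * X - 2) * (X ^ 2 + 2 * X + 4) * (X ^ 2 - X + 1)"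
    by algebra
  finally show ?thesis .
qed

lemma one_add_nonzero: "X ^ 3 \<noteq> (-1 :: 'a::field) \<Longrightarrow> 1 + X \<noteq> 0"
  by (auto simp: add_eq_0_iff)

text \<open>Up to denominators and constants, \<open>fricke\<close> turns X^3 - 8 into X(X^2 + 2X +
  4), whose second factor divides X^3 - 8, and reproduces X^6 + 20X^3 - 8 with the factor
  -27.\<close>

lemma fricke_in_generic:
  assumes two: "(2::'a::field) \<noteq> 0" and three: "(3::'a) \<noteq> 0" and X: "(X :: 'a) \<in> generic"
  shows "fricke X \<in> generic"
proof -
  define Y where "Y = fricke X"
  have X1: "1 + X \<noteq> 0" and X2: "X \<noteq> 2"
    using X by (auto simp: generic_def intro!: one_add_nonzero)
  have Y: "Y * (1 + X) = 2 - X" using X1 by (simp add: Y_def fricke_def)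
  have "(9 :: 'a) = 3 * 3" "(27 :: 'a) = 3 * 3 * 3" by simp_all
  hence num: "(9 :: 'a) \<noteq> 0" "(27 :: 'a) \<noteq> 0" using three by (metis mult_eq_0_iff)+
  have "Y \<noteq> 0" using X1 X2 by (simp add: Y_def fricke_def)
  moreover have "Y ^ 3 \<noteq> -1"
    unfolding Y_def using X three by (intro fricke_cube_ne_minus_one) (auto simp: generic_def)
  moreover have "Y ^ 3 \<noteq> 8"
  proof
    assume "Y ^ 3 = 8"
    have "(Y * (1 + X)) ^ 3 = 8 * (1 + X) ^ 3" by (simp add: power_mult_distrib \<open>Y ^ 3 = 8\<close>)
    hence "9 * (X * (X ^ 2 + 2 * X + 4)) = 0" unfolding Y by algebra
    hence "X ^ 2 + 2 * X + 4 = 0" using num X by (auto simp: generic_def)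
    hence "X ^ 3 = 8" by algebra
    thus False using X by (simp add: generic_def)
  qed
  moreover have "Y ^ 6 + 20 * Y ^ 3 - 8 \<noteq> 0"
  proof
    assume "Y ^ 6 + 20 * Y ^ 3 - 8 = 0"
    have "(Y * (1 + X)) ^ 6 + 20 * (Y * (1 + X)) ^ 3 * (1 + X) ^ 3 - 8 * (1 + X) ^ 6 =
        (Y ^ 6 + 20 * Y ^ 3 - 8) * (1 + X) ^ 6" by algebra
    hence "(2 - X) ^ 6 + 20 * (2 - X) ^ 3 * (1 + X) ^ 3 - 8 * (1 + X) ^ 6 = 0"
      unfolding Y \<open>Y ^ 6 + 20 * Y ^ 3 - 8 = 0\<close> by simp
    hence "27 * (X ^ 6 + 20 * X ^ 3 - 8) = 0" by algebra
    thus False using num X by (auto simp: generic_def simp del: distrib_left_numeral right_diff_distrib_numeral)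
  qed
  ultimately show ?thesis by (simp add: generic_def Y_def)
qed

locale primitive_cube_root =
  fixes \<zeta> :: "'a::finite_field"
  assumes two: "(2::'a) \<noteq> 0" and three: "(3::'a) \<noteq> 0"
    and \<zeta>_cube: "\<zeta> ^ 3 = 1" and \<zeta>_ne_1: "\<zeta> \<noteq> 1"
begin

lemma \<zeta>_quadratic: "\<zeta> ^ 2 + \<zeta> + 1 = 0"
proof -
  have "(\<zeta> - 1) * (\<zeta> ^ 2 + \<zeta> + 1) = 0" using \<zeta>_cube by algebra
  thus ?thesis using \<zeta>_ne_1 by simp
qed

lemma \<zeta>_square_quadratic: "(\<zeta> ^ 2) ^ 2 + \<zeta> ^ 2 + 1 = 0"
  using \<zeta>_quadratic by algebra

lemma \<zeta>_nonzero: "\<zeta> \<noteq> 0"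
  using \<zeta>_cube by auto

lemma \<zeta>_pow_4: "\<zeta> ^ 4 = \<zeta>"
  using \<zeta>_cube by algebra

lemma \<zeta>_square_ne: "\<zeta> ^ 2 \<noteq> 1" "\<zeta> ^ 2 \<noteq> \<zeta>"
proof -
  show "\<zeta> ^ 2 \<noteq> \<zeta>" using \<zeta>_nonzero \<zeta>_ne_1 by (simp add: power2_eq_square)
  show "\<zeta> ^ 2 \<noteq> 1"
  proof
    assume "\<zeta> ^ 2 = 1"
    hence "\<zeta> = 1" using \<zeta>_cube by (simp add: power3_eq_cube power2_eq_square)
    thus False using \<zeta>_ne_1 by simp
  qed
qed

lemma cube_eq_iff: "X ^ 3 = Y ^ 3 \<longleftrightarrow> X \<in> {Y, \<zeta> * Y, \<zeta> ^ 2 * Y}"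
proof -
  have "X ^ 3 - Y ^ 3 = (X - Y) * (X - \<zeta> * Y) * (X - \<zeta> ^ 2 * Y)"
    using \<zeta>_quadratic by algebra
  hence "X ^ 3 - Y ^ 3 = 0 \<longleftrightarrow> X \<in> {Y, \<zeta> * Y, \<zeta> ^ 2 * Y}" by auto
  thus ?thesis by simp
qed

lemma card_rotations: "Y \<noteq> 0 \<Longrightarrow> card {Y, \<zeta> * Y, \<zeta> ^ 2 * Y} = 3"
  using \<zeta>_square_ne \<zeta>_ne_1 by (auto simp: card_insert_if)

lemma rotate_cubes [simp]: "(\<zeta> * X) ^ 3 = X ^ 3" "(\<zeta> * X) ^ 6 = X ^ 6"
    "(\<zeta> ^ 2 * X) ^ 3 = X ^ 3" "(\<zeta> ^ 2 * X) ^ 6 = X ^ 6"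
  using \<zeta>_cube by algebra+

lemma rotate_in_generic: "X \<in> generic \<Longrightarrow> \<zeta> * X \<in> generic" "X \<in> generic \<Longrightarrow> \<zeta> ^ 2 * X \<in> generic"
  using \<zeta>_nonzero by (simp_all add: generic_def)

lemma bij_rotate_generic: "bij_betw (\<lambda>X. \<zeta> * X) generic generic"
proof (rule bij_betwI[where g = "\<lambda>X. \<zeta> ^ 2 * X"])
  show "\<zeta> ^ 2 * (\<zeta> * X) = X" "\<zeta> * (\<zeta> ^ 2 * X) = X" for X
    using \<zeta>_cube by algebra+
qed (use rotate_in_generic in auto)

lemma bij_fricke_generic: "bij_betw fricke generic (generic :: 'a set)"
proof (rule bij_betwI[where g = fricke])
  show fricke_fricke: "fricke (fricke X) = X" if "X \<in> generic" for X :: 'a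
    using that by (auto simp: generic_def one_add_nonzero fricke_fricke[OF three])
  show "fricke (fricke X) = X" if "X \<in> generic" for X :: 'a
    using that by (rule fricke_fricke)
qed (use fricke_in_generic[OF two three] in auto)

lemma twist_generic_nonzero: "X \<in> generic \<Longrightarrow> twist X \<noteq> (0::'a)"
  using twist_eq_0_iff[OF three, of X] by (auto simp: generic_def)

text \<open>The difference of the cross-multiplied sides splits into X, a constant, and divisors of
  X^3 - 8, X^3 + 1 and X^6 + 20X^3 - 8. Collisions thus occur only at X excluded from
  \<open>generic\<close>.\<close>

lemma fricke_rotate_cube_ne:
  assumes X: "X \<in> generic"
  shows "fricke (\<zeta> * X) ^ 3 \<noteq> fricke X ^ 3"
proof
  assume eq: "fricke (\<zeta> * X) ^ 3 = fricke X ^ 3"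
  have ne: "1 + X \<noteq> 0" "1 + \<zeta> * X \<noteq> 0" "X \<noteq> 0"
    using X by (auto simp: generic_def intro!: one_add_nonzero)
  have "(2 - \<zeta> * X) ^ 3 * (1 + X) ^ 3 = (2 - X) ^ 3 * (1 + \<zeta> * X) ^ 3"
    using eq ne by (simp add: fricke_def power_divide divide_eq_eq frac_eq_eq)
  moreover have "(2 - X) ^ 3 * (1 + \<zeta> * X) ^ 3 - (2 - \<zeta> * X) ^ 3 * (1 + X) ^ 3 =
      9 * (1 - \<zeta> ^ 2) * (X * ((X - 2 * \<zeta>) * (X + \<zeta>)) * (X ^ 2 + 2 * \<zeta> * X - 2 * \<zeta> ^ 2))"
    using \<zeta>_quadratic by algebra
  moreover have "(9::'a) = 3 * 3" by simp
  hence "(9::'a) \<noteq> 0" using three by (metis mult_eq_0_iff)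
  ultimately have "(X - 2 * \<zeta>) * (X + \<zeta>) * (X ^ 2 + 2 * \<zeta> * X - 2 * \<zeta> ^ 2) = 0"
    using \<zeta>_square_ne ne by auto
  then consider "X - 2 * \<zeta> = 0" | "X + \<zeta> = 0" | "X ^ 2 + 2 * \<zeta> * X - 2 * \<zeta> ^ 2 = 0" by auto
  thus False
  proof cases
    case 1
    hence "X ^ 3 = 8" using \<zeta>_cube by algebra
    thus ?thesis using X by (simp add: generic_def)
  next
    case 2
    hence "X ^ 3 = -1" using \<zeta>_cube by algebra
    thus ?thesis using X by (simp add: generic_def)
  next
    case 3
    hence "X ^ 6 + 20 * X ^ 3 - 8 = 0" using \<zeta>_quadratic by algebra
    thus ?thesis using X by (simp add: generic_def)
  qed
qed

lemma fricke_cube_ne: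
  assumes X: "X \<in> generic"
  shows "fricke X ^ 3 \<noteq> (X :: 'a) ^ 3"
proof
  assume "fricke X ^ 3 = X ^ 3"
  then consider "X ^ 2 + 2 * X - 2 = 0" | "X ^ 2 + 2 * X + 4 = 0" | "X ^ 2 - X + 1 = 0"
    using X by (auto simp: generic_def one_add_nonzero fricke_cube_eq_cube)
  thus False
  proof cases
    case 1
    hence "X ^ 6 + 20 * X ^ 3 - 8 = 0" by algebra
    thus ?thesis using X by (simp add: generic_def)
  next
    case 2
    hence "X ^ 3 = 8" by algebra
    thus ?thesis using X by (simp add: generic_def)
  next
    case 3
    hence "X ^ 3 = -1" by algebra
    thus ?thesis using X by (simp add: generic_def)
  qed
qed

lemma iso_class_cube:
  "iso_class (X ^ 3) =
    insert (X ^ 3) ((\<lambda>Y. fricke Y ^ 3) ` {Y \<in> {X, \<zeta> * X, \<zeta> ^ 2 * X}. nz_square (twist Y)})"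
  unfolding iso_class_def by (auto simp: cube_eq_iff)

text \<open>Different cube roots lead to different parameters by
  \<open>fricke_rotate_cube_ne\<close>, and none leads back to X^3 by
  \<open>fricke_cube_ne\<close>.\<close>

lemma card_iso_class_generic:
  assumes X: "X \<in> generic"
  shows "card (iso_class (X ^ 3)) = 1 + of_bool (nz_square (twist X)) +
    of_bool (nz_square (twist (\<zeta> * X))) + of_bool (nz_square (twist (\<zeta> ^ 2 * X)))"
proof -
  define S where "S = {Y \<in> {X, \<zeta> * X, \<zeta> ^ 2 * X}. nz_square (twist Y)}"
  have X0: "X \<noteq> 0" using X by (simp add: generic_def)
  have distinct: "X \<noteq> \<zeta> * X" "X \<noteq> \<zeta> ^ 2 * X" "\<zeta> * X \<noteq> \<zeta> ^ 2 * X"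
    using X0 \<zeta>_square_ne \<zeta>_ne_1 by auto
  have X2: "\<zeta> * (\<zeta> * X) = \<zeta> ^ 2 * X" "\<zeta> * (\<zeta> ^ 2 * X) = X"
    by algebra (use \<zeta>_cube in algebra)
  have "fricke (\<zeta> * X) ^ 3 \<noteq> fricke X ^ 3" "fricke (\<zeta> ^ 2 * X) ^ 3 \<noteq> fricke (\<zeta> * X) ^ 3"
    "fricke X ^ 3 \<noteq> fricke (\<zeta> ^ 2 * X) ^ 3"
    using fricke_rotate_cube_ne X rotate_in_generic X2 by metis+
  hence "inj_on (\<lambda>Y. fricke Y ^ 3) S"
    unfolding S_def inj_on_def by auto
  moreover have "X ^ 3 \<notin> (\<lambda>Y. fricke Y ^ 3) ` S"
  proof
    assume "X ^ 3 \<in> (\<lambda>Y. fricke Y ^ 3) ` S"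
    then obtain Y where "fricke Y ^ 3 = X ^ 3" "Y \<in> {X, \<zeta> * X, \<zeta> ^ 2 * X}"
      unfolding S_def by auto
    thus False using fricke_cube_ne[of Y] X rotate_in_generic by auto
  qed
  ultimately have "card (iso_class (X ^ 3)) = 1 + card S"
    unfolding iso_class_cube S_def[symmetric] by (simp add: card_image S_def)
  also have "S = (if nz_square (twist X) then {X} else {}) \<union>
      ((if nz_square (twist (\<zeta> * X)) then {\<zeta> * X} else {}) \<union>
       (if nz_square (twist (\<zeta> ^ 2 * X)) then {\<zeta> ^ 2 * X} else {}))"
    unfolding S_def by auto
  also have "card \<dots> = of_bool (nz_square (twist X)) +
    of_bool (nz_square (twist (\<zeta> * X))) + of_bool (nz_square (twist (\<zeta> ^ 2 * X)))"
    using distinct by (auto simp: card_insert_if)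
  finally show ?thesis by simp
qed

text \<open>The curve with j = 0. The cube root 2 has twist 0, and the others are zeros of X^2 + 2X
  + 4, where \<open>fricke\<close> preserves the cube.\<close>

lemma iso_class_8: "iso_class (8::'a) = {8}"
proof -
  have "fricke Y ^ 3 = 8" if "Y ^ 3 = 8" "nz_square (twist Y)" for Y :: 'a
  proof -
    have "Y - 2 \<noteq> 0" "1 + Y \<noteq> 0"
      using that twist_eq_0_iff[OF three, of Y]
      by (auto simp: nz_square_def eq_neg_iff_add_eq_0 add.commute)
    moreover have "(Y - 2) * (Y ^ 2 + 2 * Y + 4) = Y ^ 3 - 8" by algebra
    hence "(Y - 2) * (Y ^ 2 + 2 * Y + 4) = 0" using that(1) by simp
    ultimately have "fricke Y ^ 3 = Y ^ 3" by (simp add: fricke_cube_eq_cube)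
    thus ?thesis using that by simp
  qed
  thus ?thesis unfolding iso_class_def by auto
qed

lemma nz_square_minus_3: "nz_square (-3 :: 'a)"
proof -
  have "-3 = (2 * \<zeta> + 1) ^ 2" using \<zeta>_quadratic by algebra
  thus ?thesis using three by (auto simp: nz_square_def)
qed

section \<open>From sums over parameters to sums over cube roots\<close>

lemma cube_fibre: "{X. X ^ 3 = Y ^ 3} = {Y, \<zeta> * Y, \<zeta> ^ 2 * Y}"
  using cube_eq_iff by blast

lemma sum_over_cubes:
  fixes h :: "'a \<Rightarrow> real"
  assumes "0 \<notin> C"
  shows "(\<Sum>X | X ^ 3 \<in> C. h (X ^ 3)) = 3 * (\<Sum>c\<in>{c \<in> C. \<exists>Y. c = Y ^ 3}. h c)"
proof -
  let ?U = "{X. X ^ 3 \<in> C}"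
  have "(\<Sum>X\<in>?U. h (X ^ 3)) = (\<Sum>c\<in>(\<lambda>X. X ^ 3) ` ?U. \<Sum>X\<in>{X \<in> ?U. X ^ 3 = c}. h (X ^ 3))"
    by (rule sum.image_gen) simp
  also have "(\<lambda>X. X ^ 3) ` ?U = {c \<in> C. \<exists>Y. c = Y ^ 3}" by auto
  also have "(\<Sum>c\<in>\<dots>. \<Sum>X\<in>{X \<in> ?U. X ^ 3 = c}. h (X ^ 3)) = (\<Sum>c\<in>{c \<in> C. \<exists>Y. c = Y ^ 3}. 3 * h c)"
  proof (rule sum.cong)
    fix c assume c: "c \<in> {c \<in> C. \<exists>Y. c = Y ^ 3}"
    then obtain Y where Y: "c = Y ^ 3" by blast
    have "{X \<in> ?U. X ^ 3 = c} = {X. X ^ 3 = Y ^ 3}" using c Y by auto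
    moreover have "Y \<noteq> 0" using c Y assms by auto
    hence "card {X. X ^ 3 = Y ^ 3} = 3" unfolding cube_fibre by (rule card_rotations)
    ultimately show "(\<Sum>X\<in>{X \<in> ?U. X ^ 3 = c}. h (X ^ 3)) = 3 * h c"
      using Y by simp
  qed simp
  finally show ?thesis by (simp add: sum_distrib_left)
qed

lemma card_cube_eq: "card {X. X ^ 3 = (-1::'a)} = 3" "card {X. X ^ 3 = (8::'a)} = 3"
proof -
  have "(-1 :: 'a) = (-1) ^ 3" "(8 :: 'a) = 2 ^ 3" by simp_all
  thus "card {X. X ^ 3 = (-1::'a)} = 3" "card {X. X ^ 3 = (8::'a)} = 3"
    using card_rotations[of "-1"] card_rotations[of 2] two unfolding cube_fibre[symmetric] by simp_all
qed

lemma sum_split_minus_1: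
  fixes g :: "'a \<Rightarrow> real"
  shows "(\<Sum>X\<in>UNIV. g X) = g 0 + (\<Sum>X | X ^ 3 = -1. g X) + (\<Sum>X | X ^ 3 \<in> UNIV - {0, -1}. g X)"
proof -
  have "(UNIV :: 'a set) = insert 0 ({X. X ^ 3 = -1} \<union> {X. X ^ 3 \<in> UNIV - {0, -1}})" by auto
  hence "(\<Sum>X\<in>UNIV. g X) = (\<Sum>X\<in>insert 0 ({X. X ^ 3 = -1} \<union> {X. X ^ 3 \<in> UNIV - {0, -1}}). g X)"
    by (rule arg_cong)
  also have "\<dots> = g 0 + (\<Sum>X\<in>{X. X ^ 3 = -1} \<union> {X. X ^ 3 \<in> UNIV - {0, -1}}. g X)"
    by (rule sum.insert) auto
  also have "(\<Sum>X\<in>{X. X ^ 3 = -1} \<union> {X. X ^ 3 \<in> UNIV - {0, -1}}. g X) =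
      (\<Sum>X | X ^ 3 = -1. g X) + (\<Sum>X | X ^ 3 \<in> UNIV - {0, -1}. g X)"
    by (rule sum.union_disjoint) auto
  finally show ?thesis by simp
qed

text \<open>The parameters that are not cubes are alone in their classes and number 2(q - 1)/3. Over
  the cubes the sum is taken over cube roots instead, which triples it.\<close>

lemma I_T_eq_sum_cubes:
  "3 * real (I_T TYPE('a)) = 2 * (real CARD('a) - 1) +
    (\<Sum>X | X ^ 3 \<in> UNIV - {0, -1 :: 'a}. 1 / real (card (iso_class (X ^ 3))))"
proof -
  define D where "D = UNIV - {0, -1 :: 'a}"
  define K where "K = {c \<in> D. \<exists>Y. c = Y ^ 3}"
  have 0: "0 \<notin> D" by (simp add: D_def)
  have "K \<subseteq> D" by (auto simp: K_def)
  have "real CARD('a) = 1 + 3 + real (card {X :: 'a. X ^ 3 \<in> D})"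
    using sum_split_minus_1[of "\<lambda>_. 1"] card_cube_eq by (simp add: D_def)
  also have "real (card {X :: 'a. X ^ 3 \<in> D}) = 3 * real (card K)"
    using sum_over_cubes[OF 0, of "\<lambda>_. 1"] by (simp add: K_def)
  \<comment> \<open>q = 1 + 3 + 3|K|, from X = 0, X^3 = -1 and the fibres over
    \<open>K\<close>.\<close>
  finally have K: "3 * real (card K) = real CARD('a) - 4" by simp
  have "card D = CARD('a) - 2" unfolding D_def by (subst card_Diff_subset) auto
  moreover have "2 \<le> CARD('a)" using card_mono[of UNIV "{0, 1 :: 'a}"] by simp
  ultimately have D: "real (card D) = real CARD('a) - 2" by simp
  have "real (I_T TYPE('a)) = (\<Sum>c\<in>D - K. 1 / real (card (iso_class c))) + (\<Sum>c\<in>K. 1 / real (card (iso_class c)))"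
    unfolding I_T_eq_sum_iso_class[OF two three] D_def[symmetric]
    using \<open>K \<subseteq> D\<close> by (intro sum.subset_diff) auto
  also have "(\<Sum>c\<in>D - K. 1 / real (card (iso_class c))) = (\<Sum>c\<in>D - K. 1)"
  proof (rule sum.cong)
    fix c assume "c \<in> D - K"
    hence "iso_class c = {c}" by (auto simp: K_def iso_class_def)
    thus "1 / real (card (iso_class c)) = 1" by simp
  qed simp
  also have "\<dots> = real (card D) - real (card K)"
    using \<open>K \<subseteq> D\<close> by (simp add: card_Diff_subset card_mono)
  finally have "3 * real (I_T TYPE('a)) = 3 * real (card D) - 3 * real (card K) +
      3 * (\<Sum>c\<in>K. 1 / real (card (iso_class c)))" by simp
  also have "3 * (\<Sum>c\<in>K. 1 / real (card (iso_class c))) =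
      (\<Sum>X | X ^ 3 \<in> D. 1 / real (card (iso_class (X ^ 3))))"
    unfolding K_def by (rule sum_over_cubes[OF 0, symmetric])
  finally show ?thesis unfolding K D by (simp add: D_def)
qed

text \<open>The X over j = 1728, that is over the roots u of 2u^2 - 6u + 3.\<close>

abbreviation harmonic :: "'a set" where
  "harmonic \<equiv> {X. X ^ 6 + 20 * X ^ 3 - 8 = 0}"

text \<open>At 0, -1 and 8 the polynomial t^2 + 20t - 8 has the values -8, -27 and 216, products of
  powers of 2 and 3 up to sign.\<close>

lemma harmonic_cube_ne:
  assumes "X \<in> harmonic"
  shows "X \<noteq> 0" "X ^ 3 \<noteq> -1" "X ^ 3 \<noteq> 8"
proof -
  have X: "(X ^ 3) ^ 2 + 20 * X ^ 3 - 8 = 0" using assms by (simp flip: power_mult)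
  have "(8 :: 'a) = 2 * 2 * 2" "(27 :: 'a) = 3 * 3 * 3" "(216 :: 'a) = 2 * 2 * 2 * (3 * 3 * 3)" by simp_all
  hence num: "(8 :: 'a) \<noteq> 0" "(27 :: 'a) \<noteq> 0" "(216 :: 'a) \<noteq> 0"
    using two three by (metis mult_eq_0_iff)+
  show "X \<noteq> 0" using X num by auto
  show "X ^ 3 \<noteq> -1"
  proof
    assume "X ^ 3 = -1"
    hence "(-1) ^ 2 + 20 * (-1) - 8 = (0 :: 'a)" using X by metis
    moreover have "(-1) ^ 2 + 20 * (-1) - 8 = - (27 :: 'a)" by simp
    ultimately show False using num by simp
  qed
  show "X ^ 3 \<noteq> 8"
  proof
    assume "X ^ 3 = 8"
    hence "8 ^ 2 + 20 * 8 - 8 = (0 :: 'a)" using X by metis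
    moreover have "8 ^ 2 + 20 * 8 - 8 = (216 :: 'a)" by simp
    ultimately show False using num by simp
  qed
qed

lemma sum_split_generic:
  fixes g :: "'a \<Rightarrow> real"
  shows "(\<Sum>X | X ^ 3 \<in> UNIV - {0, -1}. g X) =
    (\<Sum>X | X ^ 3 = 8. g X) + (\<Sum>X\<in>harmonic. g X) + (\<Sum>X\<in>generic. g X)"
proof -
  have "(8 :: 'a) = 2 * 2 * 2" "(9 :: 'a) = 3 * 3" by simp_all
  hence num: "(8 :: 'a) \<noteq> 0" "(9 :: 'a) \<noteq> 0" using two three by (metis mult_eq_0_iff)+
  hence "(8 :: 'a) \<noteq> -1" by (auto simp: eq_neg_iff_add_eq_0)
  hence "{X. X ^ 3 \<in> UNIV - {0, -1}} = ({X. X ^ 3 = 8} \<union> harmonic) \<union> generic"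
    using harmonic_cube_ne num by (auto simp: generic_def)
  moreover have "(\<Sum>X\<in>({X. X ^ 3 = 8} \<union> harmonic) \<union> generic. g X) =
      (\<Sum>X\<in>{X. X ^ 3 = 8} \<union> harmonic. g X) + (\<Sum>X\<in>generic. g X)"
    by (rule sum.union_disjoint) (auto simp: generic_def)
  moreover have "(\<Sum>X\<in>{X. X ^ 3 = 8} \<union> harmonic. g X) =
      (\<Sum>X | X ^ 3 = 8. g X) + (\<Sum>X\<in>harmonic. g X)"
    using harmonic_cube_ne by (intro sum.union_disjoint) auto
  ultimately show ?thesis by simp
qed

section \<open>The contribution of the generic fibres\<close>

lemma rotate_rotate: "\<zeta> * (\<zeta> * X) = \<zeta> ^ 2 * X" "\<zeta> * (\<zeta> ^ 2 * X) = X"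
  "\<zeta> ^ 2 * (\<zeta> * X) = X" "\<zeta> ^ 2 * (\<zeta> ^ 2 * X) = \<zeta> * X"
  by algebra (use \<zeta>_cube in algebra)+

lemma nz_square_twist_fricke_generic:
  assumes X: "X \<in> generic" and card: "CARD('a) = 2 * m + 1"
  shows "nz_square (twist (fricke X)) \<longleftrightarrow> nz_square (twist X)"
    "nz_square (twist (\<zeta> * fricke X)) \<longleftrightarrow> (nz_square (twist X) \<longleftrightarrow> nz_square (twist (\<zeta> ^ 2 * X)))"
    "nz_square (twist (\<zeta> ^ 2 * fricke X)) \<longleftrightarrow> (nz_square (twist X) \<longleftrightarrow> nz_square (twist (\<zeta> * X)))"
proof -
  have ne: "X \<noteq> 0" "1 + X \<noteq> 0" using X by (auto simp: generic_def intro!: one_add_nonzero)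
  note tw = twist_generic_nonzero[OF X] twist_generic_nonzero[OF rotate_in_generic(1)[OF X]]
    twist_generic_nonzero[OF rotate_in_generic(2)[OF X]]
  show "nz_square (twist (fricke X)) \<longleftrightarrow> nz_square (twist X)"
    unfolding twist_fricke[OF ne(2)] using ne three by (intro nz_square_mult_square_iff) simp
  have "nz_square (twist (\<zeta> * fricke X)) \<longleftrightarrow> nz_square (twist X * twist (\<zeta> ^ 2 * X))"
    unfolding twist_rotate_fricke[OF \<zeta>_quadratic ne(2,1)] using ne \<zeta>_nonzero
    by (intro nz_square_mult_square_iff) simp
  thus "nz_square (twist (\<zeta> * fricke X)) \<longleftrightarrow> (nz_square (twist X) \<longleftrightarrow> nz_square (twist (\<zeta> ^ 2 * X)))"
    using nz_square_mult_iff[OF two card] tw by simp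
  \<comment> \<open>The third equivalence is the second with \<zeta>^2 in place of \<zeta>.\<close>
  have "(\<zeta> ^ 2) ^ 2 * X = \<zeta> * X" using \<zeta>_cube by algebra
  hence "nz_square (twist (\<zeta> ^ 2 * fricke X)) \<longleftrightarrow> nz_square (twist X * twist (\<zeta> * X))"
    unfolding twist_rotate_fricke[OF \<zeta>_square_quadratic ne(2,1)] using ne \<zeta>_nonzero
    by (subst nz_square_mult_square_iff) simp_all
  thus "nz_square (twist (\<zeta> ^ 2 * fricke X)) \<longleftrightarrow> (nz_square (twist X) \<longleftrightarrow> nz_square (twist (\<zeta> * X)))"
    using nz_square_mult_iff[OF two card] tw by simp
qed

text \<open>In this form the predicate visibly depends on X^3 only, which lets
  \<open>all_square_harmonic\<close> pass to another cube root.\<close>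

definition all_square :: "'a \<Rightarrow> bool" where
  "all_square X \<longleftrightarrow> (\<forall>Y. Y ^ 3 = X ^ 3 \<longrightarrow> nz_square (twist Y))"

lemma all_square_iff:
  "all_square X \<longleftrightarrow> nz_square (twist X) \<and> nz_square (twist (\<zeta> * X)) \<and> nz_square (twist (\<zeta> ^ 2 * X))"
  unfolding all_square_def cube_eq_iff by auto

text \<open>For n = 0, 1, 2, 3 squares, 1/(1 + n) exceeds 1/2 - [n = 3]/4 by 1/2, 0, -1/6, 0. There
  are three times as many X with n = 2 as with n = 0, so the errors cancel.\<close>

lemma sum_generic:
  assumes card: "CARD('a) = 2 * m + 1"
  shows "(\<Sum>X\<in>generic. 1 / real (card (iso_class ((X::'a) ^ 3)))) =
    real (card (generic :: 'a set)) / 2 - real (card {X \<in> generic. all_square X}) / 4"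
proof -
  define F :: "'a \<Rightarrow> real" where
    "F X = of_bool (\<not> nz_square (twist X) \<and> nz_square (twist (\<zeta> * X)) \<and> nz_square (twist (\<zeta> ^ 2 * X)))" for X
  have 1: "(\<Sum>X\<in>generic. F (\<zeta> * X)) = (\<Sum>X\<in>generic. F X)"
    by (rule sum.reindex_bij_betw[OF bij_rotate_generic])
  have 2: "(\<Sum>X\<in>generic. F (\<zeta> ^ 2 * X)) = (\<Sum>X\<in>generic. F X)"
    using sum.reindex_bij_betw[OF bij_rotate_generic, of "\<lambda>X. F (\<zeta> * X)"] 1 by (simp only: rotate_rotate)
  have 3: "(\<Sum>X\<in>generic. F (fricke X)) = (\<Sum>X\<in>generic. F X)"
    by (rule sum.reindex_bij_betw[OF bij_fricke_generic])
  \<comment> \<open>\<^term>\<open>F (fricke X)\<close> says that none of the three twists is a square; the last three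
    summands say that exactly two of them are. Both contributions have the same sum.\<close>
  have "1 / real (card (iso_class (X ^ 3))) = 1 / 2 - of_bool (all_square X) / 4 +
      F (fricke X) / 2 - (F X + F (\<zeta> * X) + F (\<zeta> ^ 2 * X)) / 6" if X: "X \<in> generic" for X
    unfolding card_iso_class_generic[OF X] F_def rotate_rotate all_square_iff
      nz_square_twist_fricke_generic[OF X card]
    by (cases "nz_square (twist X)"; cases "nz_square (twist (\<zeta> * X))";
        cases "nz_square (twist (\<zeta> ^ 2 * X))") simp_all
  hence "(\<Sum>X\<in>generic. 1 / real (card (iso_class ((X::'a) ^ 3)))) = (\<Sum>X\<in>generic. 1 / 2 - of_bool (all_square X) / 4 +
      F (fricke X) / 2 - (F X + F (\<zeta> * X) + F (\<zeta> ^ 2 * X)) / 6)"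
    by (intro sum.cong) simp_all
  also have "\<dots> = real (card (generic :: 'a set)) / 2 - (\<Sum>X\<in>generic. of_bool (all_square X)) / 4"
    unfolding sum_subtractf sum.distrib sum_divide_distrib[symmetric] 1 2 3 by simp
  finally show ?thesis by (simp add: Int_def)
qed

section \<open>The fibres over j = 1728\<close>

lemma twist_rotate_harmonic:
  fixes w :: 'a
  assumes w: "w ^ 2 + 2 * w - 2 = 0" and \<xi>: "\<xi> ^ 2 + \<xi> + 1 = (0::'a)"
  shows "nz_square (twist (\<xi> * w)) \<longleftrightarrow> nz_square (2::'a)"
proof -
  define b where "b = \<xi> * w * (3 + (2 * \<xi> + 1) * (w + 1))"
  \<comment> \<open>With i = (2\<xi> + 1)(w + 1)/3 one has i^2 = -1, 2i = (1 + i)^2 and 2(1 - w) = w^2.\<close>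
  have eq: "twist (\<xi> * w) * 2 ^ 2 = 2 * b ^ 2"
    using w \<xi> unfolding twist_def b_def by algebra
  have "\<xi> ^ 3 = 1" using \<xi> by algebra
  hence "(\<xi> * w) ^ 6 + 20 * (\<xi> * w) ^ 3 - 8 = 0" using w by algebra
  hence "twist (\<xi> * w) \<noteq> 0"
    using harmonic_cube_ne[of "\<xi> * w"] twist_eq_0_iff[OF three, of "\<xi> * w"] by auto
  hence "b \<noteq> 0" using eq two by (metis mult_eq_0_iff power_not_zero power_zero_numeral)
  have "nz_square (twist (\<xi> * w)) \<longleftrightarrow> nz_square (twist (\<xi> * w) * 2 ^ 2)"
    using nz_square_mult_square_iff[OF two] by blast
  also have "\<dots> \<longleftrightarrow> nz_square (2 :: 'a)"
    unfolding eq using nz_square_mult_square_iff[OF \<open>b \<noteq> 0\<close>] by blast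
  finally show ?thesis .
qed

text \<open>X^6 + 20X^3 - 8 is the product of X^2 + 2X - 2 over the three rotations of X. Every
  fibre over j = 1728 thus contains a fixed point of \<open>fricke\<close>.\<close>

lemma harmonic_rotation:
  assumes "X \<in> harmonic"
  obtains w where "w ^ 2 + 2 * w - 2 = 0" "X ^ 3 = w ^ 3"
proof -
  have "(X ^ 2 + 2 * X - 2) * ((\<zeta> * X) ^ 2 + 2 * (\<zeta> * X) - 2) * ((\<zeta> ^ 2 * X) ^ 2 + 2 * (\<zeta> ^ 2 * X) - 2)
      = X ^ 6 + 20 * X ^ 3 - 8"
    using \<zeta>_quadratic by algebra
  also have "\<dots> = 0" using assms by simp
  finally consider "X ^ 2 + 2 * X - 2 = 0" | "(\<zeta> * X) ^ 2 + 2 * (\<zeta> * X) - 2 = 0" |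
    "(\<zeta> ^ 2 * X) ^ 2 + 2 * (\<zeta> ^ 2 * X) - 2 = 0" by auto
  thus ?thesis by cases (use that rotate_cubes in metis)+
qed

lemma harmonic_root_cube_ne:
  assumes w: "w ^ 2 + 2 * w - 2 = (0::'a)"
  shows "w \<noteq> 0" "w ^ 3 \<noteq> -1" "w ^ 3 \<noteq> 8"
proof -
  have "w ^ 6 + 20 * w ^ 3 - 8 = 0" using w by algebra
  thus "w \<noteq> 0" "w ^ 3 \<noteq> -1" "w ^ 3 \<noteq> 8" using harmonic_cube_ne[of w] by simp_all
qed

text \<open>Again the twist at a fixed point is -3 times a square, but now -3 is a square.\<close>

lemma nz_square_twist_harmonic_root:
  assumes w: "w ^ 2 + 2 * w - 2 = (0::'a)"
  shows "nz_square (twist w)"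
proof -
  have "w - 2 \<noteq> 0" using harmonic_root_cube_ne[OF w] by auto
  have "twist w = (-3) * (w - 2) ^ 2" using w unfolding twist_def by algebra
  thus ?thesis using nz_square_minus_3 nz_square_mult_square_iff[OF \<open>w - 2 \<noteq> 0\<close>] by metis
qed

lemma all_square_harmonic: "X \<in> harmonic \<Longrightarrow> all_square X \<longleftrightarrow> nz_square (2::'a)"
proof -
  assume "X \<in> harmonic"
  then obtain w where w: "w ^ 2 + 2 * w - 2 = 0" "X ^ 3 = w ^ 3" by (rule harmonic_rotation)
  hence "all_square X \<longleftrightarrow> all_square w" by (simp add: all_square_def)
  also have "\<dots> \<longleftrightarrow> nz_square (2::'a)"
    unfolding all_square_iff using nz_square_twist_harmonic_root[OF w(1)]
      twist_rotate_harmonic[OF w(1) \<zeta>_quadratic] twist_rotate_harmonic[OF w(1) \<zeta>_square_quadratic]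
    by simp
  finally show ?thesis .
qed

lemma card_iso_class_harmonic:
  assumes "X \<in> harmonic"
  shows "card (iso_class (X ^ 3)) = (if nz_square (2::'a) then 2 else 1)"
proof -
  obtain w where w: "w ^ 2 + 2 * w - 2 = 0" "X ^ 3 = w ^ 3" using assms by (rule harmonic_rotation)
  note ne = harmonic_root_cube_ne[OF w(1)]
  have ne': "1 + w \<noteq> 0" "1 + \<zeta> * w \<noteq> 0" "1 + \<zeta> ^ 2 * w \<noteq> 0"
    by (rule one_add_nonzero, use ne in simp)+
  have fixed: "fricke w ^ 3 = w ^ 3"
    using w by (simp add: fricke_cube_eq_cube[OF ne'(1)])
  have "(2 - \<zeta> ^ 2 * w) ^ 3 * (1 + \<zeta> * w) ^ 3 = (2 - \<zeta> * w) ^ 3 * (1 + \<zeta> ^ 2 * w) ^ 3"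
    using w \<zeta>_quadratic by algebra
  hence swap: "fricke (\<zeta> ^ 2 * w) ^ 3 = fricke (\<zeta> * w) ^ 3"
    using ne' by (simp add: fricke_def power_divide frac_eq_eq)
  have moved: "fricke (\<zeta> * w) ^ 3 \<noteq> w ^ 3"
  proof
    assume "fricke (\<zeta> * w) ^ 3 = w ^ 3"
    hence "fricke (\<zeta> * w) ^ 3 = (\<zeta> * w) ^ 3" by simp
    then consider "(\<zeta> * w) ^ 2 + 2 * (\<zeta> * w) - 2 = 0" | "(\<zeta> * w) ^ 2 + 2 * (\<zeta> * w) + 4 = 0" |
      "(\<zeta> * w) ^ 2 - \<zeta> * w + 1 = 0"
      unfolding fricke_cube_eq_cube[OF ne'(2)] by auto
    thus False
    proof cases
      case 1
      \<comment> \<open>Difference of the quadratic equations for \<zeta> w and w.\<close>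
      hence "w * (\<zeta> - 1) * ((\<zeta> + 1) * w + 2) = 0" using w(1) by algebra
      also have "(\<zeta> + 1) * w + 2 = 2 - \<zeta> ^ 2 * w" using \<zeta>_quadratic by algebra
      finally have "w * (\<zeta> - 1) * (2 - \<zeta> ^ 2 * w) = 0" .
      hence "2 - \<zeta> ^ 2 * w = 0" using ne \<zeta>_ne_1 by simp
      hence "w ^ 3 = 8" using \<zeta>_cube by algebra
      thus ?thesis using ne by simp
    next
      case 2
      hence "(\<zeta> * w) ^ 3 = 8" by algebra
      thus ?thesis using ne by simp
    next
      case 3
      hence "(\<zeta> * w) ^ 3 = -1" by algebra
      thus ?thesis using ne by simp
    qed
  qed
  have "{Y \<in> {w, \<zeta> * w, \<zeta> ^ 2 * w}. nz_square (twist Y)} =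
      (if nz_square (2::'a) then {w, \<zeta> * w, \<zeta> ^ 2 * w} else {w})"
    using nz_square_twist_harmonic_root[OF w(1)]
      twist_rotate_harmonic[OF w(1) \<zeta>_quadratic] twist_rotate_harmonic[OF w(1) \<zeta>_square_quadratic]
    by auto
  hence "iso_class (X ^ 3) = (if nz_square (2::'a) then {w ^ 3, fricke (\<zeta> * w) ^ 3} else {w ^ 3})"
    unfolding w(2) iso_class_cube using fixed swap by simp
  thus ?thesis using moved by simp
qed

text \<open>The fixed points w satisfy (w + 1)^2 = 3, and 3 is a square iff -1 is, because -3 is
  one. Each w accounts for three elements.\<close>

lemma card_harmonic:
  assumes card: "CARD('a) = 2 * m + 1"
  shows "card harmonic = (if even m then 6 else 0)"
proof -
  define W where "W = {w :: 'a. w ^ 2 + 2 * w - 2 = 0}"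
  have "bij_betw (\<lambda>y. y - 1) {y :: 'a. y ^ 2 = 3} W"
    by (rule bij_betwI[where g = "\<lambda>w. w + 1"])
      (auto simp: W_def power2_eq_square algebra_simps)
  hence "card W = card {y :: 'a. y ^ 2 = 3}" by (simp add: bij_betw_same_card)
  also have "\<dots> = (if nz_square (3 :: 'a) then 2 else 0)"
    unfolding card_square_roots[OF two] using three by simp
  also have "nz_square (3 :: 'a) \<longleftrightarrow> nz_square (-1 :: 'a)"
    using nz_square_mult_iff[OF two card, of "-1" "3"] nz_square_minus_3 three by simp
  also have "\<dots> \<longleftrightarrow> even m" by (rule nz_square_minus_one_iff[OF two card])
  finally have W: "card W = (if even m then 2 else 0)" .
  have "harmonic = (\<lambda>(z, w). z * w) ` ({1, \<zeta>, \<zeta> ^ 2} \<times> W)"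
  proof (intro equalityI subsetI)
    fix X assume "X \<in> harmonic"
    then obtain w where "w ^ 2 + 2 * w - 2 = 0" "X ^ 3 = w ^ 3" by (rule harmonic_rotation)
    thus "X \<in> (\<lambda>(z, w). z * w) ` ({1, \<zeta>, \<zeta> ^ 2} \<times> W)"
      unfolding cube_eq_iff W_def by force
  next
    fix X assume "X \<in> (\<lambda>(z, w). z * w) ` ({1, \<zeta>, \<zeta> ^ 2} \<times> W)"
    then obtain z w where X: "X = z * w" "z \<in> {1, \<zeta>, \<zeta> ^ 2}" "w ^ 2 + 2 * w - 2 = 0"
      by (auto simp: W_def)
    have "w ^ 6 + 20 * w ^ 3 - 8 = 0" using X(3) by algebra
    thus "X \<in> harmonic" using X by auto
  qed
  moreover have "inj_on (\<lambda>(z, w). z * w) ({1, \<zeta>, \<zeta> ^ 2} \<times> W)"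
  proof (rule inj_onI, clarify)
    fix z w z' w' assume z: "z \<in> {1, \<zeta>, \<zeta> ^ 2}" "z' \<in> {1, \<zeta>, \<zeta> ^ 2}" and w: "w \<in> W" "w' \<in> W"
      and eq: "z * w = z' * w'"
    have "(z * w) ^ 3 = w ^ 3" "(z' * w') ^ 3 = w' ^ 3" using z by auto
    hence "w ^ 3 = w' ^ 3" using eq by simp
    \<comment> \<open>w^2 + 2w - 2 = 0 gives w^3 = 6w - 4, so \<open>w\<close> is determined by its
      cube.\<close>
    hence "2 * (3 * (w - w')) = 0" using w unfolding W_def mem_Collect_eq by algebra
    hence "w = w'" using two three by (metis mult_eq_0_iff eq_iff_diff_eq_0)
    moreover have "w \<noteq> 0" using w harmonic_root_cube_ne by (auto simp: W_def)
    ultimately show "z = z' \<and> w = w'" using eq by simp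
  qed
  moreover have "card {1, \<zeta>, \<zeta> ^ 2} = 3" using card_rotations[of 1] by simp
  ultimately have "card harmonic = 3 * card W" by (simp add: card_image card_cartesian_product)
  thus ?thesis using W by simp
qed

section \<open>Points on the curve C, fibre by fibre\<close>

definition fibre_count :: "'a \<Rightarrow> nat" where
  "fibre_count X = card {y. y ^ 2 = twist X} * card {y. y ^ 2 = twist (\<zeta> * X)} *
    card {y. y ^ 2 = twist (\<zeta> ^ 2 * X)}"

lemma N1_eq_sum: "N1 \<zeta> = (\<Sum>X\<in>UNIV. fibre_count X)"
proof -
  have "curve_C_points \<zeta> = Sigma UNIV (\<lambda>X. {y. y ^ 2 = twist X} \<times>
      {y. y ^ 2 = twist (\<zeta> * X)} \<times> {y. y ^ 2 = twist (\<zeta> ^ 2 * X)})"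
    unfolding curve_C_points_def twist_def by (auto simp: mult.assoc)
  thus ?thesis
    unfolding N1_def by (simp add: fibre_count_def card_SigmaI card_cartesian_product mult.assoc)
qed

lemma fibre_count_cong:
  assumes "X ^ 3 = Y ^ 3"
  shows "fibre_count X = fibre_count Y"
  using assms unfolding cube_eq_iff fibre_count_def by (auto simp: rotate_rotate \<zeta>_pow_4)

lemma fibre_count_0: "fibre_count 0 = 1"
  by (simp add: fibre_count_def card_square_roots[OF two] twist_def)

lemma card_square_roots_square: "b \<noteq> 0 \<Longrightarrow> card {y. y ^ 2 = (b::'a) ^ 2} = 2"
  by (auto simp: card_square_roots[OF two] nz_square_def)

text \<open>One cube root is a zero of \<open>twist\<close>, and at the other two the twist is a
  nonzero square: 1 * 2 * 2 points. The fibre over 8 behaves alike.\<close>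

lemma fibre_count_minus_1:
  assumes "X ^ 3 = -1"
  shows "fibre_count X = 4"
proof -
  have tw: "twist (-1) = (0::'a)" "twist (\<zeta> * -1) = (3 * \<zeta> ^ 2) ^ 2" "twist (\<zeta> ^ 2 * -1) = (3 * \<zeta>) ^ 2"
    unfolding twist_def by simp (use \<zeta>_quadratic in algebra)+
  have "3 * \<zeta> ^ 2 \<noteq> 0" "3 * \<zeta> \<noteq> 0" using three \<zeta>_nonzero by simp_all
  hence "fibre_count (-1) = 4"
    unfolding fibre_count_def tw
      card_square_roots_square[OF \<open>3 * \<zeta> \<noteq> 0\<close>] card_square_roots_square[OF \<open>3 * \<zeta> ^ 2 \<noteq> 0\<close>]
    by simp
  moreover have "X ^ 3 = (-1) ^ 3" using assms by simp
  ultimately show ?thesis using fibre_count_cong by metis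
qed

lemma fibre_count_8:
  assumes "X ^ 3 = 8"
  shows "fibre_count X = 4"
proof -
  have tw: "twist 2 = (0::'a)" "twist (\<zeta> * 2) = (2 * 3) ^ 2" "twist (\<zeta> ^ 2 * 2) = (2 * 3) ^ 2"
    unfolding twist_def by simp (use \<zeta>_quadratic in algebra)+
  have "2 * 3 \<noteq> (0::'a)" using two three by (metis mult_eq_0_iff)
  hence "fibre_count 2 = 4"
    unfolding fibre_count_def tw card_square_roots_square[OF \<open>2 * 3 \<noteq> 0\<close>] by simp
  moreover have "X ^ 3 = 2 ^ 3" using assms by simp
  ultimately show ?thesis using fibre_count_cong by metis
qed

lemma fibre_count_other:
  assumes "X \<noteq> 0" "X ^ 3 \<noteq> -1" "X ^ 3 \<noteq> 8"
  shows "fibre_count X = 8 * of_bool (all_square X)"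
proof -
  have "twist Y \<noteq> 0" if "Y ^ 3 = X ^ 3" for Y
    using that assms twist_eq_0_iff[OF three, of Y] by auto
  hence "twist X \<noteq> 0" "twist (\<zeta> * X) \<noteq> 0" "twist (\<zeta> ^ 2 * X) \<noteq> 0" by simp_all
  thus ?thesis
    unfolding fibre_count_def all_square_iff by (simp add: card_square_roots[OF two])
qed

text \<open>25 = 1 + 3 * 4 + 3 * 4 counts the points over X = 0, X^3 = -1 and X^3 = 8. Any other X
  carries 8 points or none.\<close>

lemma N1_eq:
  "real (N1 \<zeta>) = 25 + 8 * real (card harmonic) * of_bool (nz_square (2::'a)) +
    8 * real (card {X \<in> generic. all_square X})"
proof -
  have "real (N1 \<zeta>) = (\<Sum>X\<in>UNIV. real (fibre_count X))"
    by (simp add: N1_eq_sum)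
  also have "\<dots> = 1 + (\<Sum>X | X ^ 3 = (-1::'a). 4) + ((\<Sum>X | X ^ 3 = (8::'a). 4) +
      (\<Sum>X\<in>harmonic. 8 * of_bool (nz_square (2::'a))) + (\<Sum>X\<in>generic. 8 * of_bool (all_square X)))"
    unfolding sum_split_minus_1 sum_split_generic
  proof (intro arg_cong2[where f = "(+)"] sum.cong refl)
    show "real (fibre_count X) = 8 * of_bool (nz_square (2::'a))" if "X \<in> harmonic" for X
      using fibre_count_other harmonic_cube_ne[OF that] all_square_harmonic[OF that] by simp
    show "real (fibre_count X) = 8 * of_bool (all_square X)" if "X \<in> generic" for X
      using that fibre_count_other by (simp add: generic_def)
  qed (simp_all add: fibre_count_0 fibre_count_minus_1 fibre_count_8)
  also have "(\<Sum>X\<in>generic. 8 * of_bool (all_square X)) = 8 * real (card {X \<in> generic. all_square X})"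
    unfolding sum_distrib_left[symmetric] by (simp add: Int_def)
  finally show ?thesis by (simp add: card_cube_eq)
qed

text \<open>With h = \<open>card harmonic\<close>, eliminating \<open>card generic\<close> and the
  number of all-square generic X leaves the correction h/12 if 2 is a square and h/6 otherwise,
  where h is 6 or 0.\<close>

lemma I_T_eq_N1:
  assumes card: "CARD('a) = 2 * m + 1"
  shows "real (I_T TYPE('a)) = 5 * (real CARD('a) - 1) / 6 - (real (N1 \<zeta>) - 25) / 96 +
    (if odd m then 0 else if nz_square (2::'a) then 1 / 2 else 1)"
proof -
  let ?h = "real (card harmonic)" and ?g = "real (card (generic :: 'a set))"
    and ?t = "real (card {X \<in> generic. all_square X})"
  have "real CARD('a) = 7 + ?h + ?g"
    using sum_split_minus_1[of "\<lambda>_. 1"] sum_split_generic[of "\<lambda>_. 1"] card_cube_eq by simp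
  moreover have "(\<Sum>X | X ^ 3 = (8::'a). 1 / real (card (iso_class (X ^ 3)))) = (\<Sum>X | X ^ 3 = (8::'a). 1)"
    by (intro sum.cong) (simp_all add: iso_class_8)
  moreover have "(\<Sum>X\<in>harmonic. 1 / real (card (iso_class (X ^ 3)))) =
      (\<Sum>X\<in>harmonic. if nz_square (2::'a) then 1 / 2 else 1)"
    by (intro sum.cong) (simp_all add: card_iso_class_harmonic)
  ultimately have "3 * real (I_T TYPE('a)) = 2 * (real CARD('a) - 1) +
      (3 + ?h * (if nz_square (2::'a) then 1 / 2 else 1) + (?g / 2 - ?t / 4))"
    unfolding I_T_eq_sum_cubes sum_split_generic sum_generic[OF card]
    using card_cube_eq by simp
  thus ?thesis
    using N1_eq \<open>real CARD('a) = 7 + ?h + ?g\<close> card_harmonic[OF card]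
    by (cases "even m"; cases "nz_square (2::'a)") (simp_all add: field_simps)
qed

end

section \<open>The residue classes of q modulo 24, 12 and 3\<close>

theorem theorem3:
  fixes q :: nat
  assumes "q = card (UNIV :: 'a::finite_field set)"
    and "CHAR('a) \<ge> 5"
  shows
    "(\<forall>\<zeta>::'a. \<zeta> ^ 3 = 1 \<and> \<zeta> \<noteq> 1 \<longrightarrow>
        ([q = 1] (mod 24) \<longrightarrow>
          real (I_T TYPE('a)) = (5 * real q - 2) / 6 - (real (N1 \<zeta>) - 25) / 96) \<and>
        ([q = 13] (mod 24) \<longrightarrow>
          real (I_T TYPE('a)) = (5 * real q + 1) / 6 - (real (N1 \<zeta>) - 25) / 96) \<and>
        ([q = 7] (mod 12) \<longrightarrow>
          real (I_T TYPE('a)) = 5 * (real q - 1) / 6 - (real (N1 \<zeta>) - 25) / 96)) \<and>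
     ([q = 2] (mod 3) \<longrightarrow>
        real (I_T TYPE('a)) = real q - 1 - real (N2 TYPE('a)) / 4)"
proof -
  have two: "(2::'a) \<noteq> 0" and three: "(3::'a) \<noteq> 0"
    using two_three_nonzero[OF assms(2)] by blast+
  have q: "CARD('a) = q" using assms(1) by simp
  show ?thesis
  proof (intro conjI allI impI)
    assume "[q = 2] (mod 3)"
    hence "CARD('a) = 3 * (q div 3) + 2" unfolding cong_def q by presburger
    thus "real (I_T TYPE('a)) = real q - 1 - real (N2 TYPE('a)) / 4"
      using I_T_eq_if_card_mod_3_eq_2[OF two three] q by simp
  next
    fix \<zeta> :: 'a assume \<zeta>: "\<zeta> ^ 3 = 1 \<and> \<zeta> \<noteq> 1"
    have cube_root: "primitive_cube_root \<zeta>"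
      using two three \<zeta> by unfold_locales auto
    note I_T_eq = primitive_cube_root.I_T_eq_N1[OF cube_root]
    {
      assume "[q = 1] (mod 24)"
      \<comment> \<open>(q - 1)/4 is even, so 2 is a square and the correction is 1/2.\<close>
      hence "CARD('a) = 4 * (2 * (3 * (q div 24))) + 1" unfolding cong_def q by presburger
      from I_T_eq[of "2 * (2 * (3 * (q div 24)))"] nz_square_two_iff[OF two this] this
      show "real (I_T TYPE('a)) = (5 * real q - 2) / 6 - (real (N1 \<zeta>) - 25) / 96"
        by (simp add: q field_simps)
    next
      assume "[q = 13] (mod 24)"
      \<comment> \<open>(q - 1)/4 is odd, so 2 is not a square and the correction is 1.\<close>
      hence "CARD('a) = 4 * (6 * (q div 24) + 3) + 1" unfolding cong_def q by presburger
      from I_T_eq[of "2 * (6 * (q div 24) + 3)"] nz_square_two_iff[OF two this] this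
      show "real (I_T TYPE('a)) = (5 * real q + 1) / 6 - (real (N1 \<zeta>) - 25) / 96"
        by (simp add: q field_simps)
    next
      assume "[q = 7] (mod 12)"
      \<comment> \<open>(q - 1)/2 is odd, so \<open>harmonic\<close> is empty and there is no
        correction.\<close>
      hence "CARD('a) = 2 * (6 * (q div 12) + 3) + 1" unfolding cong_def q by presburger
      from I_T_eq[OF this] this
      show "real (I_T TYPE('a)) = 5 * (real q - 1) / 6 - (real (N1 \<zeta>) - 25) / 96"
        by (simp add: q)
    }
  qed
qed

end
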